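(* Let $E$ be a Dedekind complete vector lattice that admits a (necessarily unique) Hausdorff uo-Lebesgue topology $\widehat\tau_E$, and let each of $c_1,c_2,c_3$ be either $\widehat\tau_{\mathcal{L}_{\mathrm{ob}}(E)}$ convergence in $\mathcal{L}_{\mathrm{ob}}(E)$ or strong $\widehat\tau_E$ convergence in $\mathcal{L}_{\mathrm{ob}}(E)$ (all eight combinations are allowed). Suppose that $(S_\alpha)_{\alpha\in A}$ is a net in $\mathrm{Orth}(E)$ such that $S_\alpha\xrightarrow{c_1}S$ for some $S\in\mathcal{L}_{\mathrm{ob}}(E)$, and that $(T_\beta)_{\beta\in B}$ is a net in $\mathrm{Orth}(E)$ such that $T_\beta\xrightarrow{c_2}T$ for some $T\in\mathcal{L}_{\mathrm{ob}}(E)$. Then $S,T\in\mathrm{Orth}(E)$, and $S_\alpha T_\beta\xrightarrow{c_3}ST$.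
   Context: All vector lattices are real and Archimedean. $\mathcal{L}_{\mathrm{ob}}(E)$ is the space of order bounded linear operators on $E$, a Dedekind complete vector lattice in the operator order when $E$ is Dedekind complete; $\mathrm{Orth}(E)$ is the set of orthomorphisms on $E$, i.e. of order bounded linear operators $T:E\to E$ with $T(B)\subseteq B$ for every band $B$ of $E$. In a vector lattice $G$, a net $(x_\alpha)_{\alpha\in A}$ is order convergent to $x$ ($x_\alpha\xrightarrow{\mathrm{o}}x$) if there is a net $(y_\beta)_{\beta\in B}$ in $G$ with $y_\beta\downarrow 0$ such that for every $\beta_0\in B$ there is $\alpha_0\in A$ with $|x-x_\alpha|\le y_{\beta_0}$ for all $\alpha\ge\alpha_0$; it is unbounded order convergent to $x$ ($x_\alpha\xrightarrow{\mathrm{uo}}x$) if $|x_\alpha-x|\wedge y\xrightarrow{\mathrm{o}}0$ in $G$ for all $y\in G^+$. A uo-Lebesgue topology on $G$ is a locally solid linear topology $\tau$ on $G$ such that $x_\alpha\xrightarrow{\mathrm{uo}}0$ implies $x_\alpha\xrightarrow{\tau}0$ for every net; $G$ admits at most one Hausdorff one, denoted $\widehat\tau_G$. For Dedekind complete $E$ admitting a Hausdorff uo-Lebesgue topology, $\mathcal{L}_{\mathrm{ob}}(E)$ also admits one. Strong $\widehat\tau_E$ convergence of $T_\alpha$ to $T$ in $\mathcal{L}_{\mathrm{ob}}(E)$ means $T_\alpha x\xrightarrow{\widehat\tau_E}Tx$ for all $x\in E$. The net $(S_\alpha T_\beta)$ is indexed by $A\times B$ with the product order. *)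

theory Defs
  imports "HOL-Analysis.Analysis" "HOL-Library.Lattice_Algebras"
begin

section \<open>Vector lattices\<close>

class vector_lattice = ordered_real_vector + lattice_ab_group_add_abs

(* Suprema are only required for nonempty subsets that are bounded above, so this is Dedekind
   completeness; the Archimedean property follows from it. *)
class dedekind_complete_vector_lattice = vector_lattice + conditionally_complete_lattice

definition solid :: "'g::vector_lattice set \<Rightarrow> bool" where
  "solid V \<longleftrightarrow> (\<forall>x y. y \<in> V \<and> \<bar>x\<bar> \<le> \<bar>y\<bar> \<longrightarrow> x \<in> V)"

definition band :: "'a::dedekind_complete_vector_lattice set \<Rightarrow> bool" where
  "band B \<longleftrightarrow> subspace B \<and> solid B \<and> (\<forall>D\<subseteq>B. D \<noteq> {} \<and> bdd_above D \<longrightarrow> Sup D \<in> B)"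


section \<open>Nets\<close>

text \<open>A net is a function on a directed set \<open>A\<close> with preorder \<open>r\<close>, where \<open>(a, b) \<in> r\<close> means that
  \<open>b\<close> is at or beyond \<open>a\<close>; its values outside \<open>A\<close> are irrelevant.\<close>

definition directed_set :: "'i set \<Rightarrow> 'i rel \<Rightarrow> bool" where
  "directed_set A r \<longleftrightarrow> preorder_on A r \<and> A \<noteq> {} \<and> (\<forall>a\<in>A. \<forall>b\<in>A. \<exists>c\<in>A. (a, c) \<in> r \<and> (b, c) \<in> r)"

definition product_rel :: "'i rel \<Rightarrow> 'j rel \<Rightarrow> ('i \<times> 'j) rel" where
  "product_rel r s = {((a, b), (a', b')) | a b a' b'. (a, a') \<in> r \<and> (b, b') \<in> s}"

definition tails :: "'i set \<Rightarrow> 'i rel \<Rightarrow> 'i filter" where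
  "tails A r = (INF a\<in>A. principal {b. (a, b) \<in> r})"

lemma eventually_tails:
  assumes "directed_set A r"
  shows "eventually P (tails A r) \<longleftrightarrow> (\<exists>a\<in>A. \<forall>b. (a, b) \<in> r \<longrightarrow> P b)"
proof -
  have "\<exists>c\<in>A. principal {x. (c, x) \<in> r} \<le> inf (principal {x. (a, x) \<in> r}) (principal {x. (b, x) \<in> r})"
    if ab: "a \<in> A" "b \<in> A" for a b
  proof -
    obtain c where "c \<in> A" "(a, c) \<in> r" "(b, c) \<in> r"
      using assms ab unfolding directed_set_def by blast
    moreover have "trans r"
      using assms by (simp add: directed_set_def preorder_on_def)
    ultimately show ?thesis
      unfolding trans_def by (intro bexI[of _ c]) (simp_all, blast)
  qed
  then show ?thesis
    using assms unfolding tails_def directed_set_def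
    by (subst eventually_INF_base) (auto simp: eventually_principal)
qed

lemma directed_set_product:
  assumes "directed_set A r" "directed_set B s"
  shows "directed_set (A \<times> B) (product_rel r s)"
proof -
  have "trans r" "trans s"
    using assms by (auto simp: directed_set_def preorder_on_def)
  then have "trans (product_rel r s)"
    unfolding trans_def product_rel_def by blast
  then have "preorder_on (A \<times> B) (product_rel r s)"
    using assms unfolding directed_set_def preorder_on_def refl_on_def product_rel_def by auto
  moreover have "\<exists>w\<in>A \<times> B. (u, w) \<in> product_rel r s \<and> (v, w) \<in> product_rel r s"
    if uv: "u \<in> A \<times> B" "v \<in> A \<times> B" for u v
  proof -
    obtain c where "c \<in> A" "(fst u, c) \<in> r" "(fst v, c) \<in> r"
      using assms(1) uv unfolding directed_set_def by fastforce
    moreover obtain d where "d \<in> B" "(snd u, d) \<in> s" "(snd v, d) \<in> s"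
      using assms(2) uv unfolding directed_set_def by fastforce
    ultimately show ?thesis
      unfolding product_rel_def by (intro bexI[of _ "(c, d)"]) (auto simp: prod_eq_iff)
  qed
  moreover have "A \<times> B \<noteq> {}"
    using assms by (simp add: directed_set_def)
  ultimately show ?thesis
    unfolding directed_set_def by blast
qed


section \<open>Order convergence and unbounded order convergence\<close>

definition decreases_to_zero :: "'i set \<Rightarrow> 'i rel \<Rightarrow> ('i \<Rightarrow> 'g::vector_lattice) \<Rightarrow> bool" where
  "decreases_to_zero B s y \<longleftrightarrow> directed_set B s \<and> (\<forall>(b, b')\<in>s. y b' \<le> y b) \<and>
     (\<forall>b\<in>B. 0 \<le> y b) \<and> (\<forall>z. (\<forall>b\<in>B. z \<le> y b) \<longrightarrow> z \<le> 0)"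

(* HOL cannot quantify over the type of the index set of y inside a definition. Indexing
   by the elements of the lattice itself loses nothing, see order_convI. *)
definition order_conv :: "'i set \<Rightarrow> 'i rel \<Rightarrow> ('i \<Rightarrow> 'g::vector_lattice) \<Rightarrow> 'g \<Rightarrow> bool" where
  "order_conv A r x l \<longleftrightarrow> (\<exists>(B :: 'g set) s y. decreases_to_zero B s y \<and>
     (\<forall>b\<in>B. \<exists>a\<in>A. \<forall>a'. (a, a') \<in> r \<longrightarrow> \<bar>l - x a'\<bar> \<le> y b))"

definition uo_conv :: "'i set \<Rightarrow> 'i rel \<Rightarrow> ('i \<Rightarrow> 'g::vector_lattice) \<Rightarrow> 'g \<Rightarrow> bool" where
  "uo_conv A r x l \<longleftrightarrow> (\<forall>y\<ge>0. order_conv A r (\<lambda>a. inf \<bar>x a - l\<bar> y) 0)"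

lemma order_convI:
  fixes y :: "'k \<Rightarrow> 'g::vector_lattice"
  assumes y: "decreases_to_zero B s y"
    and dom: "\<And>b. b \<in> B \<Longrightarrow> \<exists>a\<in>A. \<forall>a'. (a, a') \<in> r \<longrightarrow> \<bar>l - x a'\<bar> \<le> y b"
  shows "order_conv A r x l"
proof -
  let ?s = "{(u, v). u \<in> y ` B \<and> v \<in> y ` B \<and> v \<le> u}"
  have "preorder_on (y ` B) ?s"
    unfolding preorder_on_def refl_on_def trans_def by auto
  moreover have "\<exists>w\<in>y ` B. (u, w) \<in> ?s \<and> (v, w) \<in> ?s" if uv: "u \<in> y ` B" "v \<in> y ` B" for u v
  proof -
    obtain b c where bc: "b \<in> B" "c \<in> B" "u = y b" "v = y c"
      using uv by blast
    then obtain d where "d \<in> B" "(b, d) \<in> s" "(c, d) \<in> s"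
      using y unfolding decreases_to_zero_def directed_set_def by blast
    then show ?thesis
      using y bc unfolding decreases_to_zero_def by (intro bexI[of _ "y d"]) auto
  qed
  ultimately have "decreases_to_zero (y ` B) ?s (\<lambda>u. u)"
    using y unfolding decreases_to_zero_def directed_set_def by auto
  then show ?thesis
    unfolding order_conv_def using dom by blast
qed


section \<open>uo-Lebesgue topologies\<close>

definition locally_solid_topology :: "'g::vector_lattice topology \<Rightarrow> bool" where
  "locally_solid_topology X \<longleftrightarrow> topspace X = UNIV \<and>
     continuous_map (prod_topology X X) X (\<lambda>(x, y). x + y) \<and>
     continuous_map (prod_topology euclideanreal X) X (\<lambda>(c, x). c *\<^sub>R x) \<and>
     (\<forall>U. openin X U \<and> 0 \<in> U \<longrightarrow> (\<exists>V W. solid V \<and> V \<subseteq> U \<and> openin X W \<and> 0 \<in> W \<and> W \<subseteq> V))"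

(* All nets in 'g are covered, whatever the type of their index sets, although only one type
   of index sets can be quantified over: see uo_Lebesgue_topologyD. *)
definition uo_Lebesgue_topology :: "'g::vector_lattice topology \<Rightarrow> bool" where
  "uo_Lebesgue_topology X \<longleftrightarrow> locally_solid_topology X \<and>
     (\<forall>(A :: ('g \<times> 'g set) set) r x. directed_set A r \<and> uo_conv A r x 0 \<longrightarrow> limitin X x 0 (tails A r))"

lemma uo_Lebesgue_topologyD:
  fixes x :: "'i \<Rightarrow> 'g::vector_lattice"
  assumes X: "uo_Lebesgue_topology X" and A: "directed_set A r" and uo: "uo_conv A r x 0"
  shows "limitin X x 0 (tails A r)"
proof -
  define T where "T a = x ` {b. (a, b) \<in> r}" for a
  define I where "I = {(x b, T a) | a b. (a, b) \<in> r}"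
  define R where "R = {(p, q). p \<in> I \<and> q \<in> I \<and> snd q \<subseteq> snd p}"
  have r: "refl_on A r" "trans r" "r \<subseteq> A \<times> A"
    using A by (auto simp: directed_set_def preorder_on_def)
  have T_mono: "T b \<subseteq> T a" if "(a, b) \<in> r" for a b
    using that r(2) unfolding T_def trans_def by blast
  have in_I: "(x b, T a) \<in> I" if "(a, b) \<in> r" for a b
    using that unfolding I_def by blast
  have tail_I: "fst q \<in> T a" if q: "((x b, T a), q) \<in> R" for a b q
  proof -
    have "q \<in> I" "snd q \<subseteq> T a"
      using q by (auto simp: R_def)
    then obtain a' b' where "q = (x b', T a')" "(a', b') \<in> r"
      unfolding I_def by blast
    with \<open>snd q \<subseteq> T a\<close> show ?thesis
      by (auto simp: T_def)
  qed
  have dirI: "directed_set I R"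
    unfolding directed_set_def
  proof (intro conjI ballI)
    show "preorder_on I R"
      unfolding preorder_on_def refl_on_def trans_def R_def by auto
    obtain a where "a \<in> A"
      using A unfolding directed_set_def by blast
    then have "(x a, T a) \<in> I"
      using r(1) by (intro in_I) (simp add: refl_on_def)
    then show "I \<noteq> {}"
      by blast
    fix p q assume pq: "p \<in> I" "q \<in> I"
    then obtain a b a' b' where *: "p = (x b, T a)" "(a, b) \<in> r" "q = (x b', T a')" "(a', b') \<in> r"
      unfolding I_def by blast
    have "a \<in> A" "a' \<in> A"
      using *(2,4) r(3) by auto
    then obtain c where c: "c \<in> A" "(a, c) \<in> r" "(a', c) \<in> r"
      using A unfolding directed_set_def by blast
    have w: "(x c, T c) \<in> I"
      using c(1) r(1) by (intro in_I) (simp add: refl_on_def)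
    have "(p, (x c, T c)) \<in> R" "(q, (x c, T c)) \<in> R"
      using pq w T_mono[OF c(2)] T_mono[OF c(3)] *(1,3) by (simp_all add: R_def)
    with w show "\<exists>w\<in>I. (p, w) \<in> R \<and> (q, w) \<in> R"
      by blast
  qed
  have "uo_conv I R fst 0"
    unfolding uo_conv_def
  proof (intro allI impI)
    fix y :: 'g assume "0 \<le> y"
    with uo have "order_conv A r (\<lambda>a. inf \<bar>x a - 0\<bar> y) 0"
      by (simp only: uo_conv_def)
    then obtain B :: "'g set" and s z where z: "decreases_to_zero B s z"
      and dom: "\<forall>b\<in>B. \<exists>a\<in>A. \<forall>a'. (a, a') \<in> r \<longrightarrow> \<bar>0 - inf \<bar>x a' - 0\<bar> y\<bar> \<le> z b"
      unfolding order_conv_def by (elim exE conjE) (rule that)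
    show "order_conv I R (\<lambda>p. inf \<bar>fst p - 0\<bar> y) 0"
    proof (rule order_convI[OF z])
      fix b assume "b \<in> B"
      then obtain a where a: "a \<in> A" "\<And>a'. (a, a') \<in> r \<Longrightarrow> \<bar>0 - inf \<bar>x a' - 0\<bar> y\<bar> \<le> z b"
        using dom by blast
      have "(x a, T a) \<in> I"
        using a(1) r(1) by (intro in_I) (simp add: refl_on_def)
      moreover have "\<bar>0 - inf \<bar>fst q - 0\<bar> y\<bar> \<le> z b" if q: "((x a, T a), q) \<in> R" for q
      proof -
        obtain c where "(a, c) \<in> r" "fst q = x c"
          using tail_I[OF q] unfolding T_def by blast
        then show ?thesis using a(2)[of c] by simp
      qed
      ultimately show "\<exists>p\<in>I. \<forall>q. (p, q) \<in> R \<longrightarrow> \<bar>0 - inf \<bar>fst q - 0\<bar> y\<bar> \<le> z b"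
        by blast
    qed
  qed
  with dirI have "directed_set I R \<and> uo_conv I R fst 0" ..
  moreover have "\<forall>(A :: ('g \<times> 'g set) set) r x. directed_set A r \<and> uo_conv A r x 0 \<longrightarrow>
      limitin X x 0 (tails A r)"
    using X unfolding uo_Lebesgue_topology_def by (rule conjunct2)
  ultimately have lim: "limitin X fst 0 (tails I R)"
    by (simp only:)
  show ?thesis
    unfolding limitin_def
  proof (intro conjI allI impI)
    show "0 \<in> topspace X"
      using lim by (simp add: limitin_def)
    fix U assume "openin X U \<and> 0 \<in> U"
    with lim have "eventually (\<lambda>q. fst q \<in> U) (tails I R)"
      by (simp add: limitin_def)
    then obtain p where p: "p \<in> I" "\<And>q. (p, q) \<in> R \<Longrightarrow> fst q \<in> U"
      unfolding eventually_tails[OF dirI] by blast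
    then obtain a b where ab: "p = (x b, T a)" "(a, b) \<in> r"
      unfolding I_def by blast
    have "x c \<in> U" if "(a, c) \<in> r" for c
    proof -
      have "(p, (x c, T a)) \<in> R"
        using p(1) ab in_I[OF that] unfolding R_def by simp
      from p(2)[OF this] show ?thesis by simp
    qed
    moreover have "a \<in> A" using ab r(3) by blast
    ultimately show "eventually (\<lambda>a. x a \<in> U) (tails A r)"
      unfolding eventually_tails[OF A] by blast
  qed
qed

(* There is at most one Hausdorff uo-Lebesgue topology. *)
definition uo_topology :: "'g::vector_lattice topology" where
  "uo_topology = (THE X. uo_Lebesgue_topology X \<and> Hausdorff_space X)"


section \<open>Order bounded operators\<close>

definition order_bounded :: "('a::ordered_real_vector \<Rightarrow> 'a) \<Rightarrow> bool" where
  "order_bounded f \<longleftrightarrow> (\<forall>a b. \<exists>c d. f ` {a..b} \<subseteq> {c..d})"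

lemma order_boundedI:
  assumes "\<And>a b. \<exists>c d. \<forall>x. a \<le> x \<and> x \<le> b \<longrightarrow> c \<le> f x \<and> f x \<le> d"
  shows "order_bounded f"
  unfolding order_bounded_def
proof (intro allI)
  fix a b
  obtain c d where "\<forall>x. a \<le> x \<and> x \<le> b \<longrightarrow> c \<le> f x \<and> f x \<le> d" using assms by blast
  then have "f ` {a..b} \<subseteq> {c..d}" by auto
  then show "\<exists>c d. f ` {a..b} \<subseteq> {c..d}" by blast
qed

lemma order_boundedE:
  assumes "order_bounded f"
  obtains c d where "\<And>x. a \<le> x \<Longrightarrow> x \<le> b \<Longrightarrow> c \<le> f x \<and> f x \<le> d"
proof -
  obtain c d where "f ` {a..b} \<subseteq> {c..d}" using assms unfolding order_bounded_def by blast
  then have "c \<le> f x \<and> f x \<le> d" if "a \<le> x" "x \<le> b" for x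
    using that by (simp add: image_subset_iff)
  then show thesis by (rule that)
qed

lemma order_bounded_add:
  assumes "order_bounded f" "order_bounded g"
  shows "order_bounded (\<lambda>x. f x + g x)"
proof (rule order_boundedI)
  fix a b
  obtain c d where "\<And>x. a \<le> x \<Longrightarrow> x \<le> b \<Longrightarrow> c \<le> f x \<and> f x \<le> d"
    using order_boundedE[OF assms(1)] by blast
  moreover obtain c' d' where "\<And>x. a \<le> x \<Longrightarrow> x \<le> b \<Longrightarrow> c' \<le> g x \<and> g x \<le> d'"
    using order_boundedE[OF assms(2)] by blast
  ultimately show "\<exists>c d. \<forall>x. a \<le> x \<and> x \<le> b \<longrightarrow> c \<le> f x + g x \<and> f x + g x \<le> d"
    by (intro exI[of _ "c + c'"] exI[of _ "d + d'"]) (auto intro: add_mono)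
qed

lemma order_bounded_scaleR:
  assumes "order_bounded f"
  shows "order_bounded (\<lambda>x. k *\<^sub>R f x)"
proof (rule order_boundedI)
  fix a b
  obtain c d where cd: "\<And>x. a \<le> x \<Longrightarrow> x \<le> b \<Longrightarrow> c \<le> f x \<and> f x \<le> d"
    using order_boundedE[OF assms] by blast
  show "\<exists>c d. \<forall>x. a \<le> x \<and> x \<le> b \<longrightarrow> c \<le> k *\<^sub>R f x \<and> k *\<^sub>R f x \<le> d"
  proof (cases "0 \<le> k")
    case True
    then show ?thesis using cd
      by (intro exI[of _ "k *\<^sub>R c"] exI[of _ "k *\<^sub>R d"]) (auto intro: scaleR_left_mono)
  next
    case False
    then show ?thesis using cd
      by (intro exI[of _ "k *\<^sub>R d"] exI[of _ "k *\<^sub>R c"]) (auto intro: scaleR_left_mono_neg)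
  qed
qed

lemma order_bounded_compose:
  assumes "order_bounded f" "order_bounded g"
  shows "order_bounded (f \<circ> g)"
proof (rule order_boundedI)
  fix a b
  obtain c d where cd: "\<And>x. a \<le> x \<Longrightarrow> x \<le> b \<Longrightarrow> c \<le> g x \<and> g x \<le> d"
    using order_boundedE[OF assms(2)] by blast
  obtain c' d' where "\<And>x. c \<le> x \<Longrightarrow> x \<le> d \<Longrightarrow> c' \<le> f x \<and> f x \<le> d'"
    using order_boundedE[OF assms(1)] by blast
  with cd show "\<exists>c d. \<forall>x. a \<le> x \<and> x \<le> b \<longrightarrow> c \<le> (f \<circ> g) x \<and> (f \<circ> g) x \<le> d"
    by (intro exI[of _ c'] exI[of _ d']) auto
qed

lemma order_bounded_positive:
  assumes lin: "linear f" and pos: "\<And>x. 0 \<le> x \<Longrightarrow> 0 \<le> f x"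
  shows "order_bounded f"
proof (rule order_boundedI)
  fix a b
  have "f x \<le> f y" if "x \<le> y" for x y
    using pos[of "y - x"] that linear_diff[OF lin, of y x] by simp
  then show "\<exists>c d. \<forall>x. a \<le> x \<and> x \<le> b \<longrightarrow> c \<le> f x \<and> f x \<le> d"
    by blast
qed

lemma order_bounded_uminus: "order_bounded f \<Longrightarrow> order_bounded (\<lambda>x. - f x)"
  using order_bounded_scaleR[of f "- 1"] by simp

lemma order_bounded_diff:
  "order_bounded f \<Longrightarrow> order_bounded g \<Longrightarrow> order_bounded (\<lambda>x. f x - g x)"
  using order_bounded_add[of f "\<lambda>x. - g x"] order_bounded_uminus[of g] by simp

lemma linear_order_bounded_zero: "linear (\<lambda>_. 0) \<and> order_bounded (\<lambda>_. 0)"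
  by (intro conjI order_bounded_positive module_hom_zero order_refl)

typedef (overloaded) 'a obop = "{f :: 'a::ordered_real_vector \<Rightarrow> 'a. linear f \<and> order_bounded f}"
  morphisms apply_op Abs_obop
proof
  show "(\<lambda>_. 0) \<in> {f :: 'a::ordered_real_vector \<Rightarrow> 'a. linear f \<and> order_bounded f}"
    by (simp add: linear_order_bounded_zero)
qed

setup_lifting type_definition_obop

lift_definition compose_op :: "'a::ordered_real_vector obop \<Rightarrow> 'a obop \<Rightarrow> 'a obop" (infixl "\<circ>\<^sub>o" 55)
  is "\<lambda>f g. f \<circ> g"
  by (simp add: linear_compose order_bounded_compose)

instantiation obop :: (ordered_real_vector) real_vector
begin

lift_definition zero_obop :: "'a obop" is "\<lambda>_. 0"
  by (rule linear_order_bounded_zero)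

lift_definition plus_obop :: "'a obop \<Rightarrow> 'a obop \<Rightarrow> 'a obop" is "\<lambda>f g x. f x + g x"
  by (simp add: linear_compose_add order_bounded_add)

lift_definition scaleR_obop :: "real \<Rightarrow> 'a obop \<Rightarrow> 'a obop" is "\<lambda>c f x. c *\<^sub>R f x"
  by (simp add: linear_compose_scale_right order_bounded_scaleR)

lift_definition uminus_obop :: "'a obop \<Rightarrow> 'a obop" is "\<lambda>f x. - f x"
  by (simp add: linear_compose_neg order_bounded_uminus)

lift_definition minus_obop :: "'a obop \<Rightarrow> 'a obop \<Rightarrow> 'a obop" is "\<lambda>f g x. f x - g x"
  by (simp add: linear_compose_sub order_bounded_diff)

instance
  by standard (transfer; auto simp: algebra_simps fun_eq_iff)+

end


section \<open>The operator order\<close>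

instantiation obop :: (vector_lattice) ordered_real_vector
begin

lift_definition less_eq_obop :: "'a obop \<Rightarrow> 'a obop \<Rightarrow> bool" is "\<lambda>f g. \<forall>x\<ge>0. f x \<le> g x" .

definition less_obop :: "'a obop \<Rightarrow> 'a obop \<Rightarrow> bool" where
  "less_obop S T \<longleftrightarrow> S \<le> T \<and> \<not> T \<le> S"

instance
proof
  fix S T :: "'a obop"
  show "S < T \<longleftrightarrow> S \<le> T \<and> \<not> T \<le> S"
    by (rule less_obop_def)
  show "S = T" if "S \<le> T" "T \<le> S"
    using that
  proof transfer
    fix f g :: "'a \<Rightarrow> 'a"
    assume f: "linear f \<and> order_bounded f" and g: "linear g \<and> order_bounded g"
      and fg: "\<forall>x\<ge>0. f x \<le> g x" and gf: "\<forall>x\<ge>0. g x \<le> f x"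
    have eq: "f x = g x" if "0 \<le> x" for x
      using that fg gf by (simp add: order.antisym)
    show "f = g"
    proof
      fix x :: 'a
      have x: "x = pprt x - (- nprt x)" using prts[of x] by simp
      have "f (pprt x - (- nprt x)) = g (pprt x - (- nprt x))"
        using f g eq[of "pprt x"] eq[of "- nprt x"] by (simp only: linear_diff) simp
      then show "f x = g x" using x by simp
    qed
  qed
qed (transfer; auto intro: order.trans scaleR_left_mono scaleR_right_mono add_left_mono)+

end

text \<open>The Riesz-Kantorovich formula
  \<open>(S \<squnion> T) x = sup {S y + T (x - y) | 0 \<le> y \<le> x}\<close> for \<open>x \<ge> 0\<close>.\<close>

definition rk_sup :: "('a::dedekind_complete_vector_lattice \<Rightarrow> 'a) \<Rightarrow> ('a \<Rightarrow> 'a) \<Rightarrow> 'a \<Rightarrow> 'a" where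
  "rk_sup f g x = (SUP y\<in>{0..x}. f y + g (x - y))"

context
  fixes f g :: "'a::dedekind_complete_vector_lattice \<Rightarrow> 'a"
  assumes f: "linear f" "order_bounded f" and g: "linear g" "order_bounded g"
begin

lemma rk_sup_upper:
  assumes "0 \<le> y" "y \<le> x"
  shows "f y + g (x - y) \<le> rk_sup f g x"
proof -
  obtain c d where cd: "\<And>y. 0 \<le> y \<Longrightarrow> y \<le> x \<Longrightarrow> c \<le> f y \<and> f y \<le> d"
    using order_boundedE[OF f(2)] by blast
  obtain c' d' where cd': "\<And>y. 0 \<le> y \<Longrightarrow> y \<le> x \<Longrightarrow> c' \<le> g y \<and> g y \<le> d'"
    using order_boundedE[OF g(2)] by blast
  have "f y + g (x - y) \<le> d + d'" if "0 \<le> y" "y \<le> x" for y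
    using cd[OF that] cd'[of "x - y"] that by (intro add_mono) auto
  then have "bdd_above ((\<lambda>y. f y + g (x - y)) ` {0..x})"
    by (intro bdd_aboveI[of _ "d + d'"]) auto
  then show ?thesis
    unfolding rk_sup_def using assms by (intro cSUP_upper) auto
qed

lemma rk_sup_least:
  assumes "0 \<le> x" "\<And>y. 0 \<le> y \<Longrightarrow> y \<le> x \<Longrightarrow> f y + g (x - y) \<le> z"
  shows "rk_sup f g x \<le> z"
  unfolding rk_sup_def using assms by (intro cSUP_least) auto

lemma rk_sup_add:
  assumes x: "0 \<le> x" and z: "0 \<le> z"
  shows "rk_sup f g (x + z) = rk_sup f g x + rk_sup f g z"
proof (rule order.antisym)
  show "rk_sup f g (x + z) \<le> rk_sup f g x + rk_sup f g z"
  proof (rule rk_sup_least)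
    fix w assume w: "0 \<le> w" "w \<le> x + z"
    define u where "u = inf w x"
    have u: "0 \<le> u" "u \<le> x" "u \<le> w" using w x by (auto simp: u_def)
    have "w - z \<le> u" using w z unfolding u_def by (simp add: algebra_simps)
    then have wu: "0 \<le> w - u" "w - u \<le> z" using u by (auto simp: algebra_simps)
    have "f w + g (x + z - w) = (f u + g (x - u)) + (f (w - u) + g (z - (w - u)))"
      using f(1) g(1) by (simp add: linear_diff linear_add)
    also have "\<dots> \<le> rk_sup f g x + rk_sup f g z"
      using u wu by (intro add_mono rk_sup_upper) auto
    finally show "f w + g (x + z - w) \<le> rk_sup f g x + rk_sup f g z" .
  qed (use x z in simp)
  have "rk_sup f g x \<le> rk_sup f g (x + z) - rk_sup f g z"
  proof (rule rk_sup_least[OF x])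
    fix u assume u: "0 \<le> u" "u \<le> x"
    have "rk_sup f g z \<le> rk_sup f g (x + z) - (f u + g (x - u))"
    proof (rule rk_sup_least[OF z])
      fix v assume v: "0 \<le> v" "v \<le> z"
      have "(f v + g (z - v)) + (f u + g (x - u)) = f (u + v) + g (x + z - (u + v))"
        using f(1) g(1) by (simp add: linear_diff linear_add)
      also have "\<dots> \<le> rk_sup f g (x + z)"
        using u v by (intro rk_sup_upper add_mono) auto
      finally show "f v + g (z - v) \<le> rk_sup f g (x + z) - (f u + g (x - u))"
        by (simp add: le_diff_eq)
    qed
    then show "f u + g (x - u) \<le> rk_sup f g (x + z) - rk_sup f g z"
      by (simp add: algebra_simps)
  qed
  then show "rk_sup f g x + rk_sup f g z \<le> rk_sup f g (x + z)"
    by (simp add: algebra_simps)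
qed

lemma rk_sup_zero: "rk_sup f g 0 = 0"
  using rk_sup_add[of 0 0] by simp

lemma rk_sup_scaleR:
  assumes "0 \<le> c" "0 \<le> x"
  shows "rk_sup f g (c *\<^sub>R x) = c *\<^sub>R rk_sup f g x"
proof -
  have le: "rk_sup f g (k *\<^sub>R x) \<le> k *\<^sub>R rk_sup f g x" if k: "0 < k" and x: "0 \<le> x" for k x
  proof (rule rk_sup_least)
    show "0 \<le> k *\<^sub>R x" using k x by (simp add: scaleR_nonneg_nonneg)
    fix w assume w: "0 \<le> w" "w \<le> k *\<^sub>R x"
    define u where "u = inverse k *\<^sub>R w"
    have wu: "w = k *\<^sub>R u" using k by (simp add: u_def)
    have u: "0 \<le> u" using w k by (simp add: u_def scaleR_nonneg_nonneg)
    have "inverse k *\<^sub>R w \<le> inverse k *\<^sub>R (k *\<^sub>R x)"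
      using k w by (intro scaleR_left_mono) auto
    then have "u \<le> x" using k by (simp add: u_def)
    have "f w + g (k *\<^sub>R x - w) = k *\<^sub>R (f u + g (x - u))"
      using f(1) g(1) by (simp add: wu linear_diff linear_scale algebra_simps)
    also have "\<dots> \<le> k *\<^sub>R rk_sup f g x"
      using k u \<open>u \<le> x\<close> by (intro scaleR_left_mono rk_sup_upper) auto
    finally show "f w + g (k *\<^sub>R x - w) \<le> k *\<^sub>R rk_sup f g x" .
  qed
  show ?thesis
  proof (cases "c = 0")
    case True
    then show ?thesis by (simp add: rk_sup_zero)
  next
    case False
    then have c: "0 < c" using assms by simp
    have "rk_sup f g (inverse c *\<^sub>R (c *\<^sub>R x)) \<le> inverse c *\<^sub>R rk_sup f g (c *\<^sub>R x)"
      using c assms by (intro le) (auto simp: scaleR_nonneg_nonneg)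
    then have "c *\<^sub>R rk_sup f g x \<le> c *\<^sub>R (inverse c *\<^sub>R rk_sup f g (c *\<^sub>R x))"
      using c by (intro scaleR_left_mono) auto
    then have "c *\<^sub>R rk_sup f g x \<le> rk_sup f g (c *\<^sub>R x)" using c by simp
    then show ?thesis using le[OF c assms(2)] by (rule order.antisym[rotated])
  qed
qed

lemma rk_sup_ext:
  assumes "0 \<le> a" "0 \<le> b"
  shows "rk_sup f g (pprt (a - b)) - rk_sup f g (- nprt (a - b)) = rk_sup f g a - rk_sup f g b"
proof -
  let ?p = "pprt (a - b)" and ?n = "- nprt (a - b)"
  have "a + ?n = b + ?p"
    using prts[of "a - b"] by (simp add: algebra_simps)
  then have "rk_sup f g a + rk_sup f g ?n = rk_sup f g b + rk_sup f g ?p"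
    using assms rk_sup_add[of a ?n] rk_sup_add[of b ?p] by simp
  then show ?thesis by (simp add: algebra_simps)
qed

lemma linear_rk_sup: "linear (\<lambda>x. rk_sup f g (pprt x) - rk_sup f g (- nprt x))" (is "linear ?h")
proof (rule linearI)
  fix x y :: 'a
  have e: "x + y = (pprt x + pprt y) - (- nprt x + - nprt y)"
    using arg_cong2[OF prts[of x] prts[of y], of "(+)"] by (simp add: algebra_simps)
  have nn: "0 \<le> pprt x + pprt y" "0 \<le> - nprt x + - nprt y"
    by (intro add_nonneg_nonneg; simp)+
  have "?h (x + y) = rk_sup f g (pprt x + pprt y) - rk_sup f g (- nprt x + - nprt y)"
    by (simp only: e rk_sup_ext[OF nn])
  also have "\<dots> = ?h x + ?h y"
    using rk_sup_add[of "pprt x" "pprt y"] rk_sup_add[of "- nprt x" "- nprt y"] by simp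
  finally show "?h (x + y) = ?h x + ?h y" .
next
  fix c :: real and x :: 'a
  show "?h (c *\<^sub>R x) = c *\<^sub>R ?h x"
  proof (cases "0 \<le> c")
    case True
    have nn: "0 \<le> c *\<^sub>R pprt x" "0 \<le> c *\<^sub>R (- nprt x)"
      using True by (intro scaleR_nonneg_nonneg; simp)+
    have e: "c *\<^sub>R x = c *\<^sub>R pprt x - c *\<^sub>R (- nprt x)"
      using arg_cong[OF prts[of x], of "scaleR c"] by (simp add: scaleR_add_right)
    have "?h (c *\<^sub>R x) = rk_sup f g (c *\<^sub>R pprt x) - rk_sup f g (c *\<^sub>R (- nprt x))"
      by (simp only: e rk_sup_ext[OF nn])
    also have "\<dots> = c *\<^sub>R rk_sup f g (pprt x) - c *\<^sub>R rk_sup f g (- nprt x)"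
      using True rk_sup_scaleR[of c "pprt x"] rk_sup_scaleR[of c "- nprt x"] by simp
    finally show ?thesis by (simp add: scaleR_diff_right)
  next
    case False
    have nn: "0 \<le> (- c) *\<^sub>R (- nprt x)" "0 \<le> (- c) *\<^sub>R pprt x"
      using False by (intro scaleR_nonneg_nonneg; simp)+
    have e: "c *\<^sub>R x = (- c) *\<^sub>R (- nprt x) - (- c) *\<^sub>R pprt x"
      using arg_cong[OF prts[of x], of "scaleR c"] by (simp add: scaleR_add_right add.commute)
    have "?h (c *\<^sub>R x) = rk_sup f g ((- c) *\<^sub>R (- nprt x)) - rk_sup f g ((- c) *\<^sub>R pprt x)"
      by (simp only: e rk_sup_ext[OF nn])
    also have "\<dots> = (- c) *\<^sub>R rk_sup f g (- nprt x) - (- c) *\<^sub>R rk_sup f g (pprt x)"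
      using False rk_sup_scaleR[of "- c" "- nprt x"] rk_sup_scaleR[of "- c" "pprt x"] by simp
    finally show ?thesis by (simp add: algebra_simps)
  qed
qed

lemma rk_sup_ge1: "0 \<le> x \<Longrightarrow> f x \<le> rk_sup f g x"
  using rk_sup_upper[of x x] linear_0[OF g(1)] by simp

lemma rk_sup_ge2: "0 \<le> x \<Longrightarrow> g x \<le> rk_sup f g x"
  using rk_sup_upper[of 0 x] linear_0[OF f(1)] by simp

lemma order_bounded_rk_sup: "order_bounded (\<lambda>x. rk_sup f g (pprt x) - rk_sup f g (- nprt x))"
proof -
  let ?h = "\<lambda>x. rk_sup f g (pprt x) - rk_sup f g (- nprt x)"
  have "order_bounded (\<lambda>x. ?h x - f x)"
    using linear_compose_sub[OF linear_rk_sup f(1)] rk_sup_ge1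
    by (intro order_bounded_positive) (auto simp: rk_sup_zero)
  from order_bounded_add[OF this f(2)] show ?thesis by simp
qed

end

instantiation obop :: (dedekind_complete_vector_lattice) vector_lattice
begin

lift_definition sup_obop :: "'a obop \<Rightarrow> 'a obop \<Rightarrow> 'a obop"
  is "\<lambda>f g x. rk_sup f g (pprt x) - rk_sup f g (- nprt x)"
  by (auto intro: linear_rk_sup order_bounded_rk_sup)

definition inf_obop :: "'a obop \<Rightarrow> 'a obop \<Rightarrow> 'a obop" where
  "inf_obop S T = - sup (- S) (- T)"

definition abs_obop :: "'a obop \<Rightarrow> 'a obop" where
  "abs_obop S = sup S (- S)"

instance
proof
  fix S T R :: "'a obop"
  have sup1: "S \<le> sup S T" for S T :: "'a obop"
    by transfer (auto simp: rk_sup_zero rk_sup_ge1)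
  have sup2: "T \<le> sup S T" for S T :: "'a obop"
    by transfer (auto simp: rk_sup_zero rk_sup_ge2)
  have sup3: "sup S T \<le> R" if "S \<le> R" "T \<le> R" for S T R :: "'a obop"
    using that
  proof (transfer, intro allI impI)
    fix f h g :: "'a \<Rightarrow> 'a" and x :: 'a
    assume f: "linear f \<and> order_bounded f" and g: "linear g \<and> order_bounded g"
      and h: "linear h \<and> order_bounded h"
      and fh: "\<forall>x\<ge>0. f x \<le> h x" and gh: "\<forall>x\<ge>0. g x \<le> h x" and x: "0 \<le> x"
    have "rk_sup f g x \<le> h x"
    proof (rule rk_sup_least)
      fix y assume "0 \<le> y" "y \<le> x"
      then have "f y + g (x - y) \<le> h y + h (x - y)"
        using fh gh by (intro add_mono) auto
      then show "f y + g (x - y) \<le> h x" using h by (simp add: linear_diff)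
    qed (use f g x in auto)
    then show "rk_sup f g (pprt x) - rk_sup f g (- nprt x) \<le> h x"
      using x f g by (simp add: rk_sup_zero)
  qed
  show "S \<le> sup S T" "T \<le> sup S T"
    by (rule sup1, rule sup2)
  show "sup S T \<le> R" if "S \<le> R" "T \<le> R"
    using that by (rule sup3)
  show "inf S T \<le> S" "inf S T \<le> T"
    using sup1[of "- S" "- T"] sup2[of "- T" "- S"] unfolding inf_obop_def
    by (metis neg_le_iff_le minus_minus)+
  show "R \<le> inf S T" if "R \<le> S" "R \<le> T"
    using that sup3[of "- S" "- R" "- T"] unfolding inf_obop_def
    by (metis neg_le_iff_le minus_minus)
  show "\<bar>S\<bar> = sup S (- S)"
    by (rule abs_obop_def)
qed

end


section \<open>Orthomorphisms and convergence of operators\<close>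

definition Orth :: "'a::dedekind_complete_vector_lattice obop set" where
  "Orth = {T. \<forall>B. band B \<longrightarrow> apply_op T ` B \<subseteq> B}"

datatype op_convergence = Uo_Lebesgue | Strong_uo_Lebesgue

fun op_conv :: "op_convergence \<Rightarrow> 'i set \<Rightarrow> 'i rel \<Rightarrow>
    ('i \<Rightarrow> 'a::dedekind_complete_vector_lattice obop) \<Rightarrow> 'a obop \<Rightarrow> bool" where
  "op_conv Uo_Lebesgue A r T L \<longleftrightarrow> limitin uo_topology T L (tails A r)"
| "op_conv Strong_uo_Lebesgue A r T L \<longleftrightarrow>
     (\<forall>x. limitin uo_topology (\<lambda>a. apply_op (T a) x) (apply_op L x) (tails A r))"

end

theory Submission
  imports Defs
begin

text \<open>Orthomorphisms behave like multiplication operators, and the theorem says that multiplication is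
jointly continuous. For a net of orthomorphisms both notions of convergence to \<open>L\<close> turn out to mean
the same, namely \<open>\<bar>T\<^sub>a - L\<bar> x \<rightarrow> 0\<close> in the topology of \<open>E\<close> for all \<open>x \<ge> 0\<close>
(\<open>op_conv_imp_abs_null\<close>, \<open>abs_null_imp_op_conv\<close>), so that all eight combinations reduce to one.

Two inequalities for positive orthomorphisms carry the argument. The first,
\<open>A x \<sqinter> B x \<le> 2 (A \<sqinter> B) x\<close> (\<open>Orth_inf_apply_le\<close>), relates infima of operators to infima of values;
it identifies the two convergences and yields \<open>\<bar>T\<bar> x = \<bar>T x\<bar>\<close>. The second, \<open>A y \<sqinter> w \<le> A w + y\<close>
(\<open>Orth_inf_le_add\<close>), controls a product: with \<open>A = \<bar>S\<^sub>a - S\<bar>\<close> and \<open>y = \<bar>T\<^sub>b - T\<bar> x\<close>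
it bounds \<open>A y \<sqinter> w\<close> by two terms that tend to zero separately. This suffices because the topology
of \<open>E\<close> is unbounded: a net tends to zero as soon as its truncations \<open>\<bar>x\<^sub>a\<bar> \<sqinter> w\<close> do. The limits
are orthomorphisms because bands are closed; for the topology of the operator lattice this is applied
to \<open>\<bar>T\<^sub>a\<bar> \<sqinter> \<bar>L\<bar>\<close>, which converges pointwise to \<open>\<bar>L\<bar>\<close>.

Both the unboundedness on \<open>E\<close> and a concrete description of the topology on the operator lattice
come from one construction. If \<open>X\<close> is a Hausdorff uo-Lebesgue topology on \<open>E\<close>, and \<open>\<Phi>\<close> is a set of
positive order continuous linear maps \<open>G \<rightarrow> E\<close> separating the points of the positive cone, then the
convergence \<open>\<phi> (\<bar>x\<^sub>a - x\<bar> \<sqinter> r) \<rightarrow> 0\<close> for all \<open>\<phi> \<in> \<Phi>\<close> and \<open>r \<ge> 0\<close> comes from a Hausdorff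
uo-Lebesgue topology on \<open>G\<close> (\<open>unbounded_topology\<close>). The identity on \<open>E\<close> gives the first application,
the evaluations at positive elements give the second.

That these topologies are the ones meant is the uniqueness theorem \<open>Hausdorff_uo_Lebesgue_unique\<close>.
If a neighbourhood \<open>U\<close> of zero for \<open>Y\<close> were none for \<open>X\<close>, there would be positive \<open>x\<^sub>n \<notin> U\<close>
in rapidly shrinking \<open>X\<close>-neighbourhoods \<open>W\<^sub>n\<close>. The intersection \<open>N\<close> of the \<open>W\<^sub>n\<close> is a band; they
are chosen so small that the component of \<open>x\<^sub>n\<close> in \<open>N\<close> is negligible for \<open>Y\<close>. The remaining parts
are unbounded order convergent to zero, since the suprema of the tails of their truncations lie in
the \<open>W\<^sub>n\<close>, so that their infimum lies in \<open>N\<close>, while it is disjoint from \<open>N\<close>. Hence they converge to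
zero for \<open>Y\<close>, a contradiction.\<close>

section \<open>Vector lattices\<close>

text \<open>These rules rewrite an infimum as the supremum of negated elements and so destroy the form in
  which the lemmas on infima apply.\<close>

declare neg_inf_eq_sup [simp del] neg_sup_eq_inf [simp del]
  diff_inf_eq_sup [simp del] diff_sup_eq_inf [simp del]

lemma scaleR_inf_distrib:
  fixes a b :: "'a::vector_lattice"
  assumes "0 \<le> c"
  shows "c *\<^sub>R inf a b = inf (c *\<^sub>R a) (c *\<^sub>R b)"
proof (cases "c = 0")
  case False
  then have c: "0 < c" using assms by simp
  show ?thesis
  proof (rule order.antisym)
    show "c *\<^sub>R inf a b \<le> inf (c *\<^sub>R a) (c *\<^sub>R b)"
      using assms by (intro inf_greatest scaleR_left_mono) auto
    have "inverse c *\<^sub>R inf (c *\<^sub>R a) (c *\<^sub>R b) \<le> inverse c *\<^sub>R (c *\<^sub>R a)"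
      "inverse c *\<^sub>R inf (c *\<^sub>R a) (c *\<^sub>R b) \<le> inverse c *\<^sub>R (c *\<^sub>R b)"
      using c by (intro scaleR_left_mono; simp)+
    then have "inverse c *\<^sub>R inf (c *\<^sub>R a) (c *\<^sub>R b) \<le> inf a b"
      using c by simp
    then have "c *\<^sub>R (inverse c *\<^sub>R inf (c *\<^sub>R a) (c *\<^sub>R b)) \<le> c *\<^sub>R inf a b"
      using assms by (rule scaleR_left_mono)
    then show "inf (c *\<^sub>R a) (c *\<^sub>R b) \<le> c *\<^sub>R inf a b"
      using c by simp
  qed
qed simp

lemma abs_scaleR_vector_lattice:
  fixes x :: "'a::vector_lattice"
  shows "\<bar>c *\<^sub>R x\<bar> = \<bar>c\<bar> *\<^sub>R \<bar>x\<bar>"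
proof -
  have *: "\<bar>k *\<^sub>R x\<bar> = k *\<^sub>R \<bar>x\<bar>" if "0 \<le> k" for k
  proof -
    have "k *\<^sub>R inf x (- x) = inf (k *\<^sub>R x) (- (k *\<^sub>R x))"
      using that by (simp add: scaleR_inf_distrib)
    then have "k *\<^sub>R (- inf x (- x)) = - inf (k *\<^sub>R x) (- (k *\<^sub>R x))"
      by (simp only: scaleR_minus_right)
    then show ?thesis
      by (simp only: neg_inf_eq_sup minus_minus abs_lattice sup_commute)
  qed
  show ?thesis
    using *[of c] *[of "- c"] by (cases "0 \<le> c") auto
qed

lemma inf_add_le:
  fixes a b c :: "'a::vector_lattice"
  assumes "0 \<le> a" "0 \<le> b" "0 \<le> c"
  shows "inf (a + b) c \<le> inf a c + inf b c"
proof -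
  have "inf (a + b) c \<le> a + inf b c"
    using assms by (simp add: add_inf_distrib_left le_infI2 add_increasing)
  moreover have "inf (a + b) c \<le> c + inf b c"
    using assms by (simp add: le_infI2 add_increasing2)
  ultimately show ?thesis
    by (simp add: add_inf_distrib_right)
qed

lemma abs_inf_diff_le:
  fixes a b c :: "'a::vector_lattice"
  assumes "0 \<le> a" "0 \<le> b" "0 \<le> c"
  shows "\<bar>inf a c - inf b c\<bar> \<le> inf \<bar>a - b\<bar> c"
proof -
  have *: "inf a c - inf b c \<le> inf \<bar>a - b\<bar> c" if "0 \<le> b" for a b
  proof -
    have "a \<le> b + \<bar>a - b\<bar>"
      using abs_ge_self[of "a - b"] by (simp add: algebra_simps)
    then have "inf a c \<le> inf (b + \<bar>a - b\<bar>) c"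
      by (rule inf_mono) simp
    also have "\<dots> \<le> inf b c + inf \<bar>a - b\<bar> c"
      using assms that by (intro inf_add_le) auto
    finally show ?thesis by (simp only: diff_le_eq add.commute)
  qed
  show ?thesis
    using *[of b a] *[of a b] assms by (intro abs_leI) (auto simp: abs_minus_commute)
qed

lemma inf_pprt_nprt:
  fixes x :: "'a::vector_lattice"
  shows "inf (pprt x) (- nprt x) = 0"
proof -
  have "inf (pprt x) (- nprt x) = inf (x + - nprt x) (0 + - nprt x)"
    by (metis add.left_neutral add_diff_cancel prts diff_conv_add_uminus)
  also have "\<dots> = 0"
    unfolding add_inf_distrib_right[symmetric] by (simp add: nprt_def)
  finally show ?thesis .
qed

lemma two_inf_eq:
  fixes a b :: "'a::vector_lattice"
  shows "a + b = \<bar>a - b\<bar> + (inf a b + inf a b)"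
proof -
  have "\<bar>a - b\<bar> + (inf a b + inf a b) = sup a b + inf a b"
  proof -
    have "sup a b - inf a b = \<bar>a - b\<bar>"
    proof (rule order.antisym)
      have "a - b \<le> \<bar>a - b\<bar>" "b - a \<le> \<bar>a - b\<bar>" by (metis abs_ge_self abs_minus_commute)+
      then have "a \<le> b + \<bar>a - b\<bar>" "b \<le> a + \<bar>a - b\<bar>" by (simp_all add: algebra_simps)
      then have "sup a b \<le> a + \<bar>a - b\<bar>" "sup a b \<le> b + \<bar>a - b\<bar>" by auto
      then have "sup a b \<le> inf a b + \<bar>a - b\<bar>" by (simp add: add_inf_distrib_right)
      then show "sup a b - inf a b \<le> \<bar>a - b\<bar>" by (simp add: algebra_simps)
      show "\<bar>a - b\<bar> \<le> sup a b - inf a b"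
        by (intro abs_leI) (simp_all add: diff_mono)
    qed
    then show ?thesis by (simp add: algebra_simps)
  qed
  then show ?thesis using add_eq_inf_sup[of a b] by simp
qed

lemma inf_scaleR_le:
  fixes x y :: "'a::vector_lattice"
  assumes "1 \<le> c" "0 \<le> y"
  shows "inf (c *\<^sub>R x) y \<le> c *\<^sub>R inf x y"
proof -
  have "1 *\<^sub>R y \<le> c *\<^sub>R y" using assms by (rule scaleR_right_mono)
  then show ?thesis using assms by (simp add: scaleR_inf_distrib le_infI2)
qed

lemma solidD: "solid V \<Longrightarrow> y \<in> V \<Longrightarrow> \<bar>x\<bar> \<le> \<bar>y\<bar> \<Longrightarrow> x \<in> V"
  unfolding solid_def by blast

lemma solidD_nonneg: "solid V \<Longrightarrow> y \<in> V \<Longrightarrow> 0 \<le> x \<Longrightarrow> x \<le> y \<Longrightarrow> x \<in> V"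
  using solidD[of V y x] by (auto intro: order.trans abs_ge_self)

lemma solid_Int: "solid V \<Longrightarrow> solid W \<Longrightarrow> solid (V \<inter> W)"
  unfolding solid_def by blast

text \<open>Disjointness of \<open>z\<close> and \<open>d\<close> means \<open>z + d = z \<squnion> d\<close>, and in this form it passes to suprema.\<close>

lemma inf_Sup_eq_0:
  fixes z :: "'a::dedekind_complete_vector_lattice"
  assumes "D \<noteq> {}" "bdd_above D" and z: "\<And>d. d \<in> D \<Longrightarrow> inf z d = 0" "0 \<le> z"
  shows "inf z (Sup D) = 0"
proof (rule order.antisym)
  have "d \<le> sup z (Sup D) - z" if "d \<in> D" for d
  proof -
    have "z + d = sup z d" using add_eq_inf_sup[of z d] z that by simp
    also have "\<dots> \<le> sup z (Sup D)" using that assms by (intro sup_mono cSup_upper) auto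
    finally show ?thesis by (simp add: algebra_simps)
  qed
  then have "Sup D \<le> sup z (Sup D) - z" using assms by (intro cSup_least)
  then show "inf z (Sup D) \<le> 0" using add_eq_inf_sup[of z "Sup D"] by (simp add: algebra_simps)
  obtain d where "d \<in> D" using assms by blast
  then have "0 \<le> d" "d \<le> Sup D" using z(1)[of d] inf_le2[of z d] assms by (simp_all add: cSup_upper)
  then show "0 \<le> inf z (Sup D)" using z by auto
qed

text \<open>Bands in a Dedekind complete vector lattice are projection bands; \<open>p\<close> is the component of \<open>x\<close> in \<open>B\<close>,
the largest element of \<open>B\<close> below \<open>x\<close>.\<close>

lemma band_decomp:
  fixes x :: "'a::dedekind_complete_vector_lattice"
  assumes B: "band B" and x: "0 \<le> x"
  obtains p q where "x = p + q" "0 \<le> p" "0 \<le> q" "p \<in> B" "\<forall>z\<in>B. z \<le> x \<longrightarrow> z \<le> p" "\<forall>z\<in>B. 0 \<le> z \<longrightarrow> inf z q = 0"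
proof -
  have sub: "subspace B" and sol: "solid B" and sup: "\<And>D. D \<subseteq> B \<Longrightarrow> D \<noteq> {} \<Longrightarrow> bdd_above D \<Longrightarrow> Sup D \<in> B"
    using B unfolding band_def by auto
  define D where "D = {z \<in> B. z \<le> x}"
  define p where "p = Sup D"
  have D: "0 \<in> D" "bdd_above D" "D \<subseteq> B"
    unfolding D_def using x sub by (auto simp: subspace_0 intro: bdd_aboveI[of _ x])
  have p: "p \<in> B" unfolding p_def using D by (intro sup) auto
  have px: "p \<le> x" unfolding p_def using D by (intro cSup_least) (auto simp: D_def)
  have p0: "0 \<le> p" unfolding p_def using D by (intro cSup_upper) auto
  have max: "z \<le> p" if "z \<in> B" "z \<le> x" for z
    unfolding p_def using D that by (intro cSup_upper) (auto simp: D_def)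
  have disj: "inf z (x - p) = 0" if z: "z \<in> B" "0 \<le> z" for z
  proof (rule order.antisym)
    have "inf z (x - p) \<in> B" using sol z px by (auto intro: solidD_nonneg)
    then have "p + inf z (x - p) \<in> B" using p sub by (simp add: subspace_add)
    moreover have "p + inf z (x - p) \<le> x" by (metis add.commute add_le_cancel_left diff_add_cancel inf.cobounded2)
    ultimately have "p + inf z (x - p) \<le> p" by (rule max)
    then show "inf z (x - p) \<le> 0" by simp
    show "0 \<le> inf z (x - p)" using z px by simp
  qed
  show thesis
    by (rule that[of p "x - p"]) (use p p0 px max disj in auto)
qed

text \<open>Orthomorphisms leave these bands invariant, and that makes them preserve disjointness.\<close>

lemma band_disjoint_complement:
  fixes w :: "'a::dedekind_complete_vector_lattice"
  assumes w: "0 \<le> w"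
  shows "band {x. inf \<bar>x\<bar> w = 0}"
proof -
  have mono: "inf \<bar>x\<bar> w = 0" if "inf y w = 0" "\<bar>x\<bar> \<le> y" for x y
  proof (rule order.antisym)
    show "inf \<bar>x\<bar> w \<le> 0" using that(1) inf_mono[OF that(2) order_refl[of w]] by simp
  qed (use w in simp)
  have sum: "inf (a + b) w = 0" if "inf a w = 0" "inf b w = 0" "0 \<le> a" "0 \<le> b" for a b
    using inf_add_le[of a b w] that w by (intro order.antisym) auto
  have add: "inf \<bar>x + y\<bar> w = 0" if "inf \<bar>x\<bar> w = 0" "inf \<bar>y\<bar> w = 0" for x y
    by (rule mono[OF sum[OF that]]) (auto intro: abs_triangle_ineq)
  have scale: "inf \<bar>c *\<^sub>R x\<bar> w = 0" if x: "inf \<bar>x\<bar> w = 0" for c x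
  proof -
    have "inf ((\<bar>c\<bar> + 1) *\<^sub>R \<bar>x\<bar>) w \<le> (\<bar>c\<bar> + 1) *\<^sub>R inf \<bar>x\<bar> w"
      using w by (intro inf_scaleR_le) auto
    then have "inf ((\<bar>c\<bar> + 1) *\<^sub>R \<bar>x\<bar>) w = 0"
      using x w by (intro order.antisym) (auto intro: scaleR_nonneg_nonneg)
    then show ?thesis
      by (rule mono) (auto simp: abs_scaleR_vector_lattice intro: scaleR_right_mono)
  qed
  have sup: "inf \<bar>Sup D\<bar> w = 0" if D: "D \<subseteq> {x. inf \<bar>x\<bar> w = 0}" "D \<noteq> {}" "bdd_above D" for D
  proof -
    obtain d0 where d0: "d0 \<in> D" using D by blast
    let ?P = "pprt ` D"
    obtain u where u: "\<And>d. d \<in> D \<Longrightarrow> d \<le> u" using D(3) unfolding bdd_above_def by blast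
    have bdd: "bdd_above ?P" using u by (intro bdd_aboveI[of _ "pprt u"]) (auto intro: pprt_mono)
    have pd: "inf w (pprt d) = 0" if "d \<in> D" for d
    proof -
      have "inf \<bar>d\<bar> w = 0" using D(1) that by blast
      moreover have "pprt d \<le> pprt \<bar>d\<bar>" by (rule pprt_mono[OF abs_ge_self])
      then have "\<bar>pprt d\<bar> \<le> \<bar>d\<bar>" by (simp only: abs_of_nonneg[OF zero_le_pprt] pprt_eq_id[OF abs_ge_zero])
      ultimately have "inf \<bar>pprt d\<bar> w = 0" by (rule mono)
      then show ?thesis by (simp add: inf_commute)
    qed
    have "inf w e = 0" if "e \<in> ?P" for e
      using that by (rule imageE) (simp add: pd)
    then have "inf w (Sup ?P) = 0"
      using D(2) bdd w by (intro inf_Sup_eq_0) simp_all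
    then have 1: "inf (Sup ?P) w = 0"
      by (simp only: inf_commute)
    have "0 \<le> Sup ?P" using d0 bdd by (metis cSup_upper2 imageI zero_le_pprt)
    moreover have "\<bar>Sup D\<bar> \<le> Sup ?P + \<bar>d0\<bar>"
    proof (intro abs_leI)
      have "d \<le> Sup ?P" if "d \<in> D" for d
        using cSup_upper[OF imageI[OF that] bdd] by (simp add: pprt_def)
      then have "Sup D \<le> Sup ?P"
        using D by (intro cSup_least)
      then show "Sup D \<le> Sup ?P + \<bar>d0\<bar>" by (simp add: add_increasing2)
      have "- Sup D \<le> - d0" using d0 D by (simp add: cSup_upper)
      also have "\<dots> \<le> \<bar>d0\<bar>" by (rule abs_ge_minus_self)
      finally show "- Sup D \<le> Sup ?P + \<bar>d0\<bar>" using \<open>0 \<le> Sup ?P\<close> by (simp add: add_increasing)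
    qed
    moreover have "inf (Sup ?P + \<bar>d0\<bar>) w = 0"
      using 1 d0 D(1) \<open>0 \<le> Sup ?P\<close> by (intro sum) auto
    ultimately show ?thesis using mono by blast
  qed
  show ?thesis
    unfolding band_def
  proof (intro conjI allI impI)
    show "subspace {x. inf \<bar>x\<bar> w = 0}"
      using add scale w by (auto simp: subspace_def inf_absorb1)
    show "solid {x. inf \<bar>x\<bar> w = 0}"
      using mono by (auto simp: solid_def)
  qed (use sup in blast)
qed

section \<open>Locally solid topologies\<close>

text \<open>Sets need not be open here, so that solid sets may serve as neighbourhoods.\<close>

definition zero_nbhd :: "'g::vector_lattice topology \<Rightarrow> 'g set \<Rightarrow> bool" where
  "zero_nbhd X U \<longleftrightarrow> (\<exists>W. openin X W \<and> 0 \<in> W \<and> W \<subseteq> U)"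

lemma zero_nbhd_mono: "zero_nbhd X U \<Longrightarrow> U \<subseteq> V \<Longrightarrow> zero_nbhd X V"
  unfolding zero_nbhd_def by blast

lemma zero_nbhd_Int: "zero_nbhd X U \<Longrightarrow> zero_nbhd X V \<Longrightarrow> zero_nbhd X (U \<inter> V)"
  unfolding zero_nbhd_def
proof (elim exE conjE)
  fix W W' assume "openin X W" "0 \<in> W" "W \<subseteq> U" "openin X W'" "0 \<in> W'" "W' \<subseteq> V"
  then show "\<exists>W. openin X W \<and> 0 \<in> W \<and> W \<subseteq> U \<inter> V"
    by (intro exI[of _ "W \<inter> W'"]) auto
qed

lemma zero_nbhd_0: "zero_nbhd X U \<Longrightarrow> 0 \<in> U"
  unfolding zero_nbhd_def by blast

lemma zero_nbhd_openin: "openin X U \<Longrightarrow> 0 \<in> U \<Longrightarrow> zero_nbhd X U"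
  unfolding zero_nbhd_def by blast

lemma limitin_eventually_zero_nbhd:
  assumes "limitin X f 0 F" "zero_nbhd X U"
  shows "eventually (\<lambda>a. f a \<in> U) F"
proof -
  obtain W where W: "openin X W" "0 \<in> W" "W \<subseteq> U" using assms(2) unfolding zero_nbhd_def by blast
  then have "eventually (\<lambda>a. f a \<in> W) F" using assms(1) unfolding limitin_def by blast
  then show ?thesis by (rule eventually_mono) (use W in blast)
qed

context
  fixes X :: "'g::vector_lattice topology"
  assumes ls: "locally_solid_topology X"
begin

lemma topspace_locally_solid: "topspace X = UNIV"
  using ls by (simp add: locally_solid_topology_def)

lemma limitin_const_locally_solid: "limitin X (\<lambda>_. l) l F"
  by (simp add: topspace_locally_solid)

lemma limitin_add_locally_solid:
  assumes "limitin X f l F" "limitin X g m F"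
  shows "limitin X (\<lambda>a. f a + g a) (l + m) F"
proof -
  have "continuous_map (prod_topology X X) X (\<lambda>(x, y). x + y)"
    using ls by (simp add: locally_solid_topology_def)
  moreover have "limitin (prod_topology X X) (\<lambda>a. (f a, g a)) (l, m) F"
    using assms by (simp add: limitin_pairwise o_def)
  ultimately show ?thesis
    by (auto dest: continuous_map_limit simp: o_def)
qed

lemma limitin_scaleR_locally_solid:
  assumes "(c \<longlongrightarrow> k) F" "limitin X f l F"
  shows "limitin X (\<lambda>a. c a *\<^sub>R f a) (k *\<^sub>R l) F"
proof -
  have "continuous_map (prod_topology euclideanreal X) X (\<lambda>(c, x). c *\<^sub>R x)"
    using ls by (simp add: locally_solid_topology_def)
  moreover have "limitin (prod_topology euclideanreal X) (\<lambda>a. (c a, f a)) (k, l) F"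
    using assms by (simp add: limitin_pairwise o_def)
  ultimately show ?thesis
    by (auto dest: continuous_map_limit simp: o_def)
qed

lemma limitin_diff_locally_solid:
  assumes "limitin X f l F" "limitin X g m F"
  shows "limitin X (\<lambda>a. f a - g a) (l - m) F"
  using limitin_add_locally_solid[OF assms(1) limitin_scaleR_locally_solid[OF tendsto_const[of "-1"] assms(2)]]
  by simp

lemma limitin_offset_locally_solid: "limitin X (\<lambda>a. f a - l) 0 F \<longleftrightarrow> limitin X f l F"
proof
  assume "limitin X (\<lambda>a. f a - l) 0 F"
  from limitin_add_locally_solid[OF this limitin_const_locally_solid[of l]]
  show "limitin X f l F" by simp
next
  assume "limitin X f l F"
  from limitin_diff_locally_solid[OF this limitin_const_locally_solid[of l]]
  show "limitin X (\<lambda>a. f a - l) 0 F" by simp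
qed

lemma solid_zero_nbhd:
  assumes "zero_nbhd X U"
  obtains V where "solid V" "zero_nbhd X V" "V \<subseteq> U"
proof -
  obtain W where W: "openin X W" "0 \<in> W" "W \<subseteq> U" using assms unfolding zero_nbhd_def by blast
  then obtain V W' where "solid V" "V \<subseteq> W" "openin X W'" "0 \<in> W'" "W' \<subseteq> V"
    using ls unfolding locally_solid_topology_def by meson
  then show thesis using W by (intro that[of V]) (auto simp: zero_nbhd_def)
qed

lemma limitin_squeeze_locally_solid:
  assumes f: "limitin X f 0 F" and le: "eventually (\<lambda>a. \<bar>g a\<bar> \<le> \<bar>f a\<bar>) F"
  shows "limitin X g 0 F"
  unfolding limitin_def
proof (intro conjI allI impI)
  fix U assume "openin X U \<and> 0 \<in> U"
  then have "zero_nbhd X U" by (simp add: zero_nbhd_openin)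
  then obtain V where V: "solid V" "zero_nbhd X V" "V \<subseteq> U" by (rule solid_zero_nbhd)
  show "eventually (\<lambda>a. g a \<in> U) F"
    using limitin_eventually_zero_nbhd[OF f V(2)] le
    by eventually_elim (use V solidD in blast)
qed (simp add: topspace_locally_solid)

lemma limitin_squeeze_nonneg:
  assumes f: "limitin X f 0 F" and g: "\<And>a. 0 \<le> g a" "eventually (\<lambda>a. g a \<le> f a) F"
  shows "limitin X g 0 F"
proof (rule limitin_squeeze_locally_solid[OF f])
  show "eventually (\<lambda>a. \<bar>g a\<bar> \<le> \<bar>f a\<bar>) F"
    using g(2) by eventually_elim (use g(1) in \<open>auto intro: order.trans abs_ge_self\<close>)
qed

lemma half_zero_nbhd:
  assumes "zero_nbhd X U"
  obtains V where "solid V" "zero_nbhd X V" "\<forall>x\<in>V. \<forall>y\<in>V. x + y \<in> U"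
proof -
  obtain W where W: "openin X W" "0 \<in> W" "W \<subseteq> U" using assms unfolding zero_nbhd_def by blast
  have "continuous_map (prod_topology X X) X (\<lambda>(x, y). x + y)"
    using ls by (simp add: locally_solid_topology_def)
  then have "openin (prod_topology X X) {p \<in> topspace (prod_topology X X). (\<lambda>(x, y). x + y) p \<in> W}"
    using W(1) by (rule openin_continuous_map_preimage)
  then have "openin (prod_topology X X) {p. fst p + snd p \<in> W}"
    by (simp add: topspace_locally_solid case_prod_unfold)
  moreover have "(0, 0) \<in> {p. fst p + snd p \<in> W}" using W by simp
  ultimately obtain A B where AB: "openin X A" "openin X B" "0 \<in> A" "0 \<in> B" "A \<times> B \<subseteq> {p. fst p + snd p \<in> W}"
    unfolding openin_prod_topology_alt by (elim allE[of _ 0] impE) auto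
  then have "zero_nbhd X (A \<inter> B)" by (intro zero_nbhd_Int zero_nbhd_openin)
  then obtain V where V: "solid V" "zero_nbhd X V" "V \<subseteq> A \<inter> B" by (rule solid_zero_nbhd)
  have "x + y \<in> U" if "x \<in> V" "y \<in> V" for x y
  proof -
    have "(x, y) \<in> A \<times> B" using that V by blast
    then have "(x, y) \<in> {p. fst p + snd p \<in> W}" using AB(5) by blast
    then show ?thesis using W(3) by auto
  qed
  with V show thesis by (intro that) auto
qed

lemma openin_translation:
  assumes "openin X U"
  shows "openin X {y. y + x \<in> U}"
proof -
  have "continuous_map X X (\<lambda>y. y + x)"
    unfolding continuous_map_atin topspace_locally_solid
  proof
    fix y
    have "limitin X (\<lambda>y. y) y (atin X y)"
      using continuous_map_id[of X] by (simp only: continuous_map_atin topspace_locally_solid id_def UNIV_I)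
    then show "limitin X (\<lambda>y. y + x) (y + x) (atin X y)"
      by (rule limitin_add_locally_solid[OF _ limitin_const_locally_solid])
  qed
  from openin_continuous_map_preimage[OF this assms] show ?thesis
    by (simp add: topspace_locally_solid)
qed

text \<open>A linear topology is determined by its neighbourhoods of zero; uniqueness will be proved for these.\<close>

lemma openin_iff_zero_nbhd: "openin X U \<longleftrightarrow> (\<forall>x\<in>U. zero_nbhd X {y. y + x \<in> U})"
proof
  assume "openin X U"
  then show "\<forall>x\<in>U. zero_nbhd X {y. y + x \<in> U}"
    by (auto intro!: zero_nbhd_openin openin_translation)
next
  assume *: "\<forall>x\<in>U. zero_nbhd X {y. y + x \<in> U}"
  show "openin X U"
  proof (subst openin_subopen, intro ballI)
    fix x assume "x \<in> U"
    then obtain W where W: "openin X W" "0 \<in> W" "W \<subseteq> {y. y + x \<in> U}"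
      using * unfolding zero_nbhd_def by blast
    have "{y. y + (- x) \<in> W} \<subseteq> U"
    proof
      fix y assume "y \<in> {y. y + (- x) \<in> W}"
      then have "y + (- x) \<in> {y. y + x \<in> U}" using W by blast
      then show "y \<in> U" by simp
    qed
    then show "\<exists>T. openin X T \<and> x \<in> T \<and> T \<subseteq> U"
      using openin_translation[OF W(1), of "- x"] W(2) by (intro exI conjI) auto
  qed
qed

lemma Hausdorff_zero_nbhd:
  assumes "Hausdorff_space X" "\<And>U. zero_nbhd X U \<Longrightarrow> z \<in> U"
  shows "z = 0"
proof (rule ccontr)
  assume "z \<noteq> 0"
  then obtain U V where "openin X U" "0 \<in> U" "z \<in> V" "disjnt U V"
    using assms(1) unfolding Hausdorff_space_def topspace_locally_solid by (metis UNIV_I)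
  with assms(2)[of U] show False by (auto simp: disjnt_def zero_nbhd_openin)
qed

lemma zero_nbhd_UNIV: "zero_nbhd X UNIV"
  using openin_topspace[of X] by (intro zero_nbhd_openin) (auto simp: topspace_locally_solid)

end

lemma locally_solid_topology_eqI:
  assumes "locally_solid_topology X" "locally_solid_topology Y"
    and "\<And>U. zero_nbhd X U \<longleftrightarrow> zero_nbhd Y U"
  shows "X = Y"
  unfolding topology_eq openin_iff_zero_nbhd[OF assms(1)] openin_iff_zero_nbhd[OF assms(2)]
  by (simp add: assms(3))

lemma uo_Lebesgue_imp_locally_solid: "uo_Lebesgue_topology X \<Longrightarrow> locally_solid_topology X"
  by (simp add: uo_Lebesgue_topology_def)

text \<open>The Lebesgue property in the form used below: a set directed downwards to zero is a net indexed by
itself and is order convergent to zero, hence it meets every neighbourhood of zero.\<close>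

lemma uo_Lebesgue_directed_inf:
  assumes X: "uo_Lebesgue_topology X" and D: "D \<noteq> {}"
    and dir: "\<And>a b. a \<in> D \<Longrightarrow> b \<in> D \<Longrightarrow> \<exists>c\<in>D. c \<le> a \<and> c \<le> b"
    and pos: "\<And>d. d \<in> D \<Longrightarrow> 0 \<le> d"
    and glb: "\<And>z. (\<And>d. d \<in> D \<Longrightarrow> z \<le> d) \<Longrightarrow> z \<le> 0"
    and U: "zero_nbhd X U"
  obtains d where "d \<in> D" "d \<in> U"
proof -
  define s where "s = {(a, b). a \<in> D \<and> b \<in> D \<and> b \<le> a}"
  have s: "directed_set D s"
    unfolding directed_set_def preorder_on_def refl_on_def trans_def s_def using D dir
    by (auto; meson order.trans)
  have dec: "decreases_to_zero D s (\<lambda>d. d)"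
    unfolding decreases_to_zero_def using s pos glb by (auto simp: s_def)
  have "uo_conv D s (\<lambda>d. d) 0"
    unfolding uo_conv_def
  proof (intro allI impI, rule order_convI[OF dec])
    fix y b :: 'a assume "0 \<le> y" "b \<in> D"
    then show "\<exists>a\<in>D. \<forall>a'. (a, a') \<in> s \<longrightarrow> \<bar>0 - inf \<bar>a' - 0\<bar> y\<bar> \<le> b"
      by (intro bexI[of _ b]) (auto simp: s_def pos le_infI1)
  qed
  from uo_Lebesgue_topologyD[OF X s this] have "limitin X (\<lambda>d. d) 0 (tails D s)" .
  from limitin_eventually_zero_nbhd[OF this U] obtain d where "d \<in> D" "\<And>b. (d, b) \<in> s \<Longrightarrow> b \<in> U"
    unfolding eventually_tails[OF s] by blast
  then show thesis by (intro that[of d]) (auto simp: s_def)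
qed

text \<open>The differences between \<open>Sup D\<close> and the finite suprema decrease to zero, so one of them lies
in \<open>V\<close>. Suprema may thus leave \<open>V\<close>, but only into \<open>V + V\<close>; this takes the place of
order closed neighbourhoods.\<close>

lemma uo_Lebesgue_Sup:
  fixes D :: "'g::dedekind_complete_vector_lattice set"
  assumes X: "uo_Lebesgue_topology X" and D: "D \<noteq> {}" "bdd_above D"
    and V: "zero_nbhd X V"
    and fin: "\<And>F. finite F \<Longrightarrow> F \<noteq> {} \<Longrightarrow> F \<subseteq> D \<Longrightarrow> Sup F \<in> V"
  shows "\<exists>a\<in>V. \<exists>b\<in>V. Sup D = a + b"
proof -
  let ?E = "{Sup D - Sup F | F. finite F \<and> F \<noteq> {} \<and> F \<subseteq> D}"
  obtain d0 where d0: "d0 \<in> D" using D by blast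
  have bdd: "bdd_above F" if "F \<subseteq> D" for F using D(2) that by (rule bdd_above_mono)
  obtain e where e: "e \<in> ?E" "e \<in> V"
  proof (rule uo_Lebesgue_directed_inf[OF X _ _ _ _ V])
    show "?E \<noteq> {}" using d0 by blast
    fix a b assume "a \<in> ?E" "b \<in> ?E"
    then obtain F G where F: "a = Sup D - Sup F" "finite F" "F \<noteq> {}" "F \<subseteq> D"
      and G: "b = Sup D - Sup G" "finite G" "G \<noteq> {}" "G \<subseteq> D" by blast
    have "Sup F \<le> Sup (F \<union> G)" "Sup G \<le> Sup (F \<union> G)"
      using F G bdd[of "F \<union> G"] by (auto intro!: cSup_subset_mono)
    then show "\<exists>c\<in>?E. c \<le> a \<and> c \<le> b"
      using F G by (intro bexI[of _ "Sup D - Sup (F \<union> G)"]) (auto intro!: exI[of _ "F \<union> G"])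
  next
    fix d assume "d \<in> ?E"
    then show "0 \<le> d" using D by (auto intro: cSup_subset_mono)
  next
    fix z assume z: "\<And>d. d \<in> ?E \<Longrightarrow> z \<le> d"
    have "d \<le> Sup D - z" if "d \<in> D" for d
    proof -
      have "z \<le> Sup D - Sup {d}" using that by (intro z) blast
      then show ?thesis by (simp add: algebra_simps)
    qed
    then have "Sup D \<le> Sup D - z" using D by (intro cSup_least) auto
    then show "z \<le> 0" by simp
  qed
  then obtain F where "e = Sup D - Sup F" "finite F" "F \<noteq> {}" "F \<subseteq> D" by blast
  then show ?thesis using e fin[of F] by (intro bexI[of _ e] bexI[of _ "Sup F"]) auto
qed

section \<open>Uniqueness of the Hausdorff uo-Lebesgue topology\<close>

text \<open>Closure of \<open>V (n + 1)\<close> under sums into \<open>V n\<close> makes such a sequence a base at zero of a linear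
topology that is coarser than \<open>X\<close> and possibly not Hausdorff; the intersection of its members
is the closure of zero for that topology.\<close>

definition normal_seq :: "'g::vector_lattice topology \<Rightarrow> (nat \<Rightarrow> 'g set) \<Rightarrow> bool" where
  "normal_seq X V \<longleftrightarrow> (\<forall>n. solid (V n) \<and> zero_nbhd X (V n) \<and>
     (\<forall>x\<in>V (Suc n). \<forall>y\<in>V (Suc n). x + y \<in> V n))"

lemma normal_seqD:
  assumes "normal_seq X V"
  shows "solid (V n)" "zero_nbhd X (V n)" "x \<in> V (Suc n) \<Longrightarrow> y \<in> V (Suc n) \<Longrightarrow> x + y \<in> V n"
  using assms unfolding normal_seq_def by auto

lemma normal_seq_decreasing:
  assumes "normal_seq X V" "m \<le> n"
  shows "V n \<subseteq> V m"
proof -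
  have "V (Suc k) \<subseteq> V k" for k
    using normal_seqD(3)[OF assms(1), of _ k 0] zero_nbhd_0[OF normal_seqD(2)[OF assms(1)]] by auto
  then show ?thesis using assms(2) by (rule lift_Suc_antimono_le)
qed

lemma normal_seq_exists:
  assumes X: "locally_solid_topology X" and U: "zero_nbhd X U"
  obtains V where "normal_seq X V" "V 0 \<subseteq> U"
proof -
  obtain V0 where V0: "solid V0" "zero_nbhd X V0" "V0 \<subseteq> U" using solid_zero_nbhd[OF X U] .
  have "\<exists>f. \<forall>n. (solid (f n) \<and> zero_nbhd X (f n) \<and> (n = 0 \<longrightarrow> f n \<subseteq> U)) \<and>
    (\<forall>x\<in>f (Suc n). \<forall>y\<in>f (Suc n). x + y \<in> f n)"
  proof (rule dependent_nat_choice)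
    show "\<exists>V. solid V \<and> zero_nbhd X V \<and> ((0::nat) = 0 \<longrightarrow> V \<subseteq> U)" using V0 by blast
    fix W and n :: nat assume "solid W \<and> zero_nbhd X W \<and> (n = 0 \<longrightarrow> W \<subseteq> U)"
    then have "zero_nbhd X W" by blast
    then obtain V where "solid V" "zero_nbhd X V" "\<forall>x\<in>V. \<forall>y\<in>V. x + y \<in> W"
      using half_zero_nbhd[OF X] by blast
    then show "\<exists>V. (solid V \<and> zero_nbhd X V \<and> (Suc n = 0 \<longrightarrow> V \<subseteq> U)) \<and> (\<forall>x\<in>V. \<forall>y\<in>V. x + y \<in> W)"
      by blast
  qed
  then obtain V where V: "\<And>n. (solid (V n) \<and> zero_nbhd X (V n) \<and> (n = 0 \<longrightarrow> V n \<subseteq> U)) \<and>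
    (\<forall>x\<in>V (Suc n). \<forall>y\<in>V (Suc n). x + y \<in> V n)" by blast
  show thesis
  proof (rule that)
    show "normal_seq X V" unfolding normal_seq_def using V by blast
    show "V 0 \<subseteq> U" using V[of 0] by blast
  qed
qed

lemma normal_seq_Int:
  "normal_seq X V \<Longrightarrow> normal_seq X W \<Longrightarrow> normal_seq X (\<lambda>n. V n \<inter> W n)"
  unfolding normal_seq_def by (simp add: solid_Int zero_nbhd_Int)

text \<open>Finite suprema stay in the intersection because it is a solid subspace, and arbitrary ones do
by \<open>uo_Lebesgue_Sup\<close>, at the price of one index.\<close>

lemma band_Inter_normal_seq:
  fixes V :: "nat \<Rightarrow> 'g::dedekind_complete_vector_lattice set"
  assumes X: "uo_Lebesgue_topology X" and V: "normal_seq X V"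
  shows "band (\<Inter>n. V n)"
proof -
  let ?N = "\<Inter>n. V n"
  have ls: "locally_solid_topology X" using X by (rule uo_Lebesgue_imp_locally_solid)
  have sol: "solid ?N" using normal_seqD(1)[OF V] unfolding solid_def by blast
  have zero: "0 \<in> ?N" using zero_nbhd_0[OF normal_seqD(2)[OF V]] by blast
  have add: "x + y \<in> ?N" if "x \<in> ?N" "y \<in> ?N" for x y
    using normal_seqD(3)[OF V, of x _ y] that by blast
  have nat: "real n *\<^sub>R x \<in> ?N" if "x \<in> ?N" for n x
  proof (induction n)
    case (Suc n)
    then have "x + real n *\<^sub>R x \<in> ?N" using add that by blast
    then show ?case by (simp only: of_nat_Suc scaleR_add_left scaleR_one)
  qed (use zero in simp)
  have scale: "c *\<^sub>R x \<in> ?N" if x: "x \<in> ?N" for c x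
  proof -
    obtain n where "\<bar>c\<bar> \<le> real n" using real_arch_simple by blast
    then have "\<bar>c *\<^sub>R x\<bar> \<le> \<bar>real n *\<^sub>R x\<bar>"
      by (simp add: abs_scaleR_vector_lattice scaleR_right_mono)
    then show ?thesis by (rule solidD[OF sol nat[OF x]])
  qed
  have fin: "Sup F \<in> ?N" if "finite F" "F \<noteq> {}" "F \<subseteq> ?N" for F
    using that
  proof (induction rule: finite_ne_induct)
    case (insert x F)
    have "\<bar>sup x (Sup F)\<bar> \<le> \<bar>x\<bar> + \<bar>Sup F\<bar>"
    proof (rule abs_leI)
      show "sup x (Sup F) \<le> \<bar>x\<bar> + \<bar>Sup F\<bar>"
        using add_mono[OF abs_ge_self[of x] abs_ge_zero[of "Sup F"]] add_mono[OF abs_ge_zero[of x] abs_ge_self[of "Sup F"]]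
        by simp
      have "- sup x (Sup F) \<le> - x" by simp
      also have "\<dots> \<le> \<bar>x\<bar> + \<bar>Sup F\<bar>"
        by (intro add_increasing2) (auto intro: abs_ge_minus_self)
      finally show "- sup x (Sup F) \<le> \<bar>x\<bar> + \<bar>Sup F\<bar>" .
    qed
    also have "\<dots> = \<bar>\<bar>x\<bar> + \<bar>Sup F\<bar>\<bar>" by simp
    finally have le: "\<bar>sup x (Sup F)\<bar> \<le> \<bar>\<bar>x\<bar> + \<bar>Sup F\<bar>\<bar>" .
    have N: "x \<in> ?N" "Sup F \<in> ?N" using insert by auto
    have "\<bar>x\<bar> \<in> ?N" "\<bar>Sup F\<bar> \<in> ?N"
      by (rule solidD[OF sol N(1) eq_refl[OF abs_idempotent]], rule solidD[OF sol N(2) eq_refl[OF abs_idempotent]])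
    then have "sup x (Sup F) \<in> ?N" by (rule solidD[OF sol add le])
    then show ?case using insert by (simp add: cSup_insert bdd_above_finite)
  qed simp
  have sup: "Sup D \<in> ?N" if D: "D \<subseteq> ?N" "D \<noteq> {}" "bdd_above D" for D
  proof
    fix n
    have "\<exists>a\<in>V (Suc n). \<exists>b\<in>V (Suc n). Sup D = a + b"
      using D fin by (intro uo_Lebesgue_Sup[OF X _ _ normal_seqD(2)[OF V]]) blast+
    then show "Sup D \<in> V n" by (auto dest: normal_seqD(3)[OF V])
  qed
  show ?thesis
    unfolding band_def subspace_def
    by (intro conjI allI impI ballI zero add scale sol; (elim conjE)?; (intro sup)?; assumption)
qed

text \<open>The components of \<open>x\<close> in the bands given by the normal sequences below \<open>V\<close> are directed downwards,
because two normal sequences can be intersected, and their infimum is zero because \<open>X\<close> is Hausdorff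
and every neighbourhood begins a normal sequence. By the Lebesgue property of \<open>Y\<close> one of these
components is in \<open>U\<close>.\<close>

lemma normal_seq_refine_on_interval:
  fixes x :: "'g::dedekind_complete_vector_lattice"
  assumes X: "uo_Lebesgue_topology X" "Hausdorff_space X" and Y: "uo_Lebesgue_topology Y"
    and V: "normal_seq X V" and U: "zero_nbhd Y U" and x: "0 \<le> x"
  obtains W where "normal_seq X W" "\<forall>n. W n \<subseteq> V n"
    "\<forall>z\<in>(\<Inter>n. W n). 0 \<le> z \<and> z \<le> x \<longrightarrow> z \<in> U"
proof -
  note lsX = uo_Lebesgue_imp_locally_solid[OF X(1)] and lsY = uo_Lebesgue_imp_locally_solid[OF Y]
  obtain U' where U': "solid U'" "zero_nbhd Y U'" "U' \<subseteq> U" using solid_zero_nbhd[OF lsY U] .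
  define comp where "comp W p \<longleftrightarrow> normal_seq X W \<and> (\<forall>n. W n \<subseteq> V n) \<and> p \<in> (\<Inter>n. W n) \<and> 0 \<le> p \<and> p \<le> x \<and>
    (\<forall>z\<in>(\<Inter>n. W n). 0 \<le> z \<and> z \<le> x \<longrightarrow> z \<le> p)" for W p
  have ex: "\<exists>p. comp W p" if W: "normal_seq X W" "\<And>n. W n \<subseteq> V n" for W
  proof -
    obtain p q where "x = p + q" "0 \<le> p" "0 \<le> q" "p \<in> (\<Inter>n. W n)"
      "\<forall>z\<in>(\<Inter>n. W n). z \<le> x \<longrightarrow> z \<le> p" "\<forall>z\<in>(\<Inter>n. W n). 0 \<le> z \<longrightarrow> inf z q = 0"
      by (rule band_decomp[OF band_Inter_normal_seq[OF X(1) W(1)] x])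
    then show ?thesis using W by (intro exI[of _ p]) (auto simp: comp_def)
  qed
  let ?D = "{p. \<exists>W. comp W p}"
  obtain p where p: "p \<in> ?D" "p \<in> U'"
  proof (rule uo_Lebesgue_directed_inf[OF Y _ _ _ _ U'(2)])
    show "?D \<noteq> {}" using ex[OF V] by blast
    fix a b assume "a \<in> ?D" "b \<in> ?D"
    then obtain W W' where W: "comp W a" "comp W' b" by blast
    have "normal_seq X (\<lambda>n. W n \<inter> W' n)"
      using W by (intro normal_seq_Int) (auto simp: comp_def)
    moreover have "W n \<inter> W' n \<subseteq> V n" for n using W by (auto simp: comp_def)
    ultimately obtain c where c: "comp (\<lambda>n. W n \<inter> W' n) c" using ex by blast
    have "c \<le> a" "c \<le> b" using c W unfolding comp_def by auto
    with c show "\<exists>c\<in>?D. c \<le> a \<and> c \<le> b" by blast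
  next
    fix d assume "d \<in> ?D" then show "0 \<le> d" by (auto simp: comp_def)
  next
    fix z assume z: "\<And>d. d \<in> ?D \<Longrightarrow> z \<le> d"
    have "pprt z = 0"
    proof (rule Hausdorff_zero_nbhd[OF lsX X(2)])
      fix G assume "zero_nbhd X G"
      then obtain G' where G': "solid G'" "zero_nbhd X G'" "G' \<subseteq> G" using solid_zero_nbhd[OF lsX] by blast
      obtain H where H: "normal_seq X H" "H 0 \<subseteq> G'" using normal_seq_exists[OF lsX G'(2)] .
      obtain p where p: "comp (\<lambda>n. V n \<inter> H n) p" using ex[OF normal_seq_Int[OF V H(1)]] by blast
      have "pprt z \<le> p" using z[of p] p by (auto simp: pprt_def comp_def)
      moreover have "p \<in> G'" using p H by (auto simp: comp_def)
      ultimately have "pprt z \<in> G'" using G'(1) by (auto intro: solidD_nonneg)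
      then show "pprt z \<in> G" using G' by blast
    qed
    then show "z \<le> 0" by (simp add: le_zero_iff_zero_pprt)
  qed
  then obtain W where W: "comp W p" by blast
  show thesis
  proof (rule that[of W]; (intro ballI impI)?)
    show "normal_seq X W" "\<forall>n. W n \<subseteq> V n" using W by (auto simp: comp_def)
    fix z assume "z \<in> (\<Inter>n. W n)" "0 \<le> z \<and> z \<le> x"
    then have "z \<le> p" using W unfolding comp_def by blast
    then show "z \<in> U" using p(2) U' \<open>0 \<le> z \<and> z \<le> x\<close> by (auto intro: solidD_nonneg)
  qed
qed

lemma sum_in_normal_seq:
  assumes V: "normal_seq X V" and g: "\<And>n. g n \<in> V n"
  shows "sum g {Suc m..m + k} \<in> V m"
proof (induction k arbitrary: m)
  case 0
  then show ?case using zero_nbhd_0[OF normal_seqD(2)[OF V]] by simp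
next
  case (Suc k)
  have "sum g {Suc (Suc m)..Suc m + k} \<in> V (Suc m)" by (rule Suc)
  then have "g (Suc m) + sum g {Suc (Suc m)..Suc m + k} \<in> V m"
    using g by (intro normal_seqD(3)[OF V])
  also have "g (Suc m) + sum g {Suc (Suc m)..Suc m + k} = sum g {Suc m..m + Suc k}"
    by (simp add: sum.atLeast_Suc_atMost)
  finally show ?case .
qed

lemma directed_set_nat: "directed_set UNIV {(m::nat, n). m \<le> n}"
proof -
  have "\<exists>c\<ge>a. b \<le> c" for a b :: nat
    by (intro exI[of _ "max a b"]) simp
  then show ?thesis
    unfolding directed_set_def preorder_on_def refl_on_def trans_def by auto
qed

text \<open>For \<open>y \<ge> 0\<close> the suprema of the tails of \<open>q \<sqinter> y\<close> dominate the truncated sequence and decrease. A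
positive lower bound of them lies in every \<open>V n\<close>, hence is disjoint from all \<open>q n\<close> and then also from
the suprema above it, so it is zero.\<close>

lemma normal_seq_uo_null:
  fixes q :: "nat \<Rightarrow> 'g::dedekind_complete_vector_lattice"
  assumes X: "uo_Lebesgue_topology X" and V: "normal_seq X V"
    and q: "\<And>n. q n \<in> V n" "\<And>n. 0 \<le> q n"
    and disj: "\<And>n z. z \<in> (\<Inter>n. V n) \<Longrightarrow> 0 \<le> z \<Longrightarrow> inf z (q n) = 0"
  shows "uo_conv UNIV {(m, n). m \<le> n} q 0"
  unfolding uo_conv_def
proof (intro allI impI)
  fix y :: 'g assume y: "0 \<le> y"
  define g where "g n = inf (q n) y" for n
  have g: "0 \<le> g n" "g n \<le> q n" "g n \<le> y" for n using q y by (auto simp: g_def)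
  have gV: "g n \<in> V n" for n using q g normal_seqD(1)[OF V] by (blast intro: solidD_nonneg)
  define \<sigma> where "\<sigma> m = Sup (g ` {m..})" for m
  have bdd: "bdd_above (g ` A)" for A using g by (intro bdd_aboveI[of _ y]) auto
  have upper: "g n \<le> \<sigma> m" if "m \<le> n" for m n
    unfolding \<sigma>_def using that by (intro cSup_upper bdd) auto
  have mono: "\<sigma> n \<le> \<sigma> m" if "m \<le> n" for m n
    unfolding \<sigma>_def using that by (intro cSup_subset_mono bdd) auto
  \<comment> \<open>One index is lost for summing up \<open>g (m + 2), g (m + 3), \<dots>\<close> and one for the passage to the supremum.\<close>
  have \<sigma>V: "\<sigma> (m + 2) \<in> V m" for m
  proof -
    have "Sup F \<in> V (Suc m)" if F: "finite F" "F \<noteq> {}" "F \<subseteq> g ` {m + 2..}" for F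
    proof -
      obtain I where I: "finite I" "I \<subseteq> {m + 2..}" "F = g ` I" using finite_subset_image[OF F(1,3)] by blast
      define k where "k = Max I"
      have "Sup F \<le> sum g {Suc (Suc m)..Suc m + k}"
      proof (rule cSup_least[OF F(2)])
        fix f assume "f \<in> F"
        then obtain i where i: "i \<in> I" "f = g i" using I by blast
        then have "m + 2 \<le> i" "i \<le> k" using I by (auto simp: k_def)
        then show "f \<le> sum g {Suc (Suc m)..Suc m + k}"
          unfolding i using sum_mono2[of "{Suc (Suc m)..Suc m + k}" "{i}" g] by (simp add: g)
      qed
      moreover have "0 \<le> Sup F"
      proof -
        obtain f where "f \<in> F" using F by blast
        moreover from this have "0 \<le> f" using I g by auto
        ultimately show ?thesis using bdd[of I] I by (auto intro: cSup_upper2)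
      qed
      ultimately show ?thesis
        using sum_in_normal_seq[OF V gV, of "Suc m" k] normal_seqD(1)[OF V] by (blast intro: solidD_nonneg)
    qed
    then have "\<exists>a\<in>V (Suc m). \<exists>b\<in>V (Suc m). \<sigma> (m + 2) = a + b"
      unfolding \<sigma>_def by (intro uo_Lebesgue_Sup[OF X _ bdd normal_seqD(2)[OF V]]) auto
    then show ?thesis by (auto dest: normal_seqD(3)[OF V])
  qed
  have "decreases_to_zero UNIV {(m, n). m \<le> n} \<sigma>"
    unfolding decreases_to_zero_def
  proof (intro conjI)
    show "directed_set UNIV {(m::nat, n). m \<le> n}"
      by (rule directed_set_nat)
    show "\<forall>(m, n)\<in>{(m, n). m \<le> n}. \<sigma> n \<le> \<sigma> m" using mono by auto
    show "\<forall>m\<in>UNIV. 0 \<le> \<sigma> m" using upper g by (blast intro: order.trans)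
    show "\<forall>z. (\<forall>m\<in>UNIV. z \<le> \<sigma> m) \<longrightarrow> z \<le> 0"
    proof (intro allI impI)
      fix z assume z: "\<forall>m\<in>UNIV. z \<le> \<sigma> m"
      have le: "pprt z \<le> \<sigma> m" for m using z upper[of m m] g[of m] by (auto simp: pprt_def intro: order.trans)
      then have "pprt z \<in> (\<Inter>n. V n)"
        using \<sigma>V normal_seqD(1)[OF V] by (blast intro: solidD_nonneg zero_le_pprt)
      then have "inf (pprt z) (q n) = 0" for n by (rule disj) simp
      then have "inf (pprt z) (g n) = 0" for n
        using inf_mono[OF order_refl[of "pprt z"] g(2)[of n]] g(1)[of n] by (intro order.antisym) auto
      then have "inf (pprt z) (\<sigma> 0) = 0"
        unfolding \<sigma>_def by (intro inf_Sup_eq_0 bdd) auto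
      then have "pprt z = 0" using le[of 0] by (simp add: inf_absorb1)
      then show "z \<le> 0" by (simp add: le_zero_iff_zero_pprt)
    qed
  qed
  then show "order_conv UNIV {(m, n). m \<le> n} (\<lambda>n. inf \<bar>q n - 0\<bar> y) 0"
  proof (rule order_convI)
    fix m :: nat
    show "\<exists>a\<in>UNIV. \<forall>n. (a, n) \<in> {(m, n). m \<le> n} \<longrightarrow> \<bar>0 - inf \<bar>q n - 0\<bar> y\<bar> \<le> \<sigma> m"
      using upper[of m] g q by (intro bexI[of _ m]) (simp_all flip: g_def)
  qed
qed

text \<open>The sequences of neighbourhoods are refined step by step: once \<open>x n\<close> has been chosen, the next normal
sequence is taken so fine that the part of \<open>x n\<close> in its band lies in \<open>U1\<close>. The diagonal sequence is
normal and finer than all of them in the sense of its band, so it works for all \<open>x n\<close> at once.\<close>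

lemma uo_Lebesgue_zero_nbhd_coarser:
  fixes X Y :: "'g::dedekind_complete_vector_lattice topology"
  assumes X: "uo_Lebesgue_topology X" "Hausdorff_space X" and Y: "uo_Lebesgue_topology Y"
    and U: "zero_nbhd Y U"
  shows "zero_nbhd X U"
proof (rule ccontr)
  assume not: "\<not> zero_nbhd X U"
  note lsX = uo_Lebesgue_imp_locally_solid[OF X(1)] and lsY = uo_Lebesgue_imp_locally_solid[OF Y]
  obtain U0 where U0: "solid U0" "zero_nbhd Y U0" "U0 \<subseteq> U" using solid_zero_nbhd[OF lsY U] .
  obtain U1 where U1: "solid U1" "zero_nbhd Y U1" "\<forall>x\<in>U1. \<forall>y\<in>U1. x + y \<in> U0"
    by (rule half_zero_nbhd[OF lsY U0(2)])
  have pick: "\<exists>x. 0 \<le> x \<and> x \<in> V \<and> x \<notin> U0" if V: "solid V" "zero_nbhd X V" for V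
  proof -
    have "\<not> V \<subseteq> U0" using not V U0 by (meson zero_nbhd_mono)
    then obtain x where x: "x \<in> V" "x \<notin> U0" by blast
    have "\<bar>x\<bar> \<in> V" using V x by (auto intro: solidD)
    moreover have "\<bar>x\<bar> \<notin> U0" using x U0(1) by (auto dest: solidD[of U0 "\<bar>x\<bar>" x])
    ultimately show ?thesis by (intro exI[of _ "\<bar>x\<bar>"]) simp
  qed
  have "\<exists>f. \<forall>n. (normal_seq X (fst (f n)) \<and> 0 \<le> snd (f n) \<and> snd (f n) \<in> fst (f n) n \<and> snd (f n) \<notin> U0) \<and>
     ((\<forall>k. fst (f (Suc n)) k \<subseteq> fst (f n) k) \<and> (\<forall>z\<in>(\<Inter>k. fst (f (Suc n)) k). 0 \<le> z \<and> z \<le> snd (f n) \<longrightarrow> z \<in> U1))"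
  proof (rule dependent_nat_choice)
    obtain V where V: "normal_seq X V" using normal_seq_exists[OF lsX zero_nbhd_UNIV[OF lsX]] by blast
    obtain x where "0 \<le> x" "x \<in> V 0" "x \<notin> U0" using pick normal_seqD(1,2)[OF V, of 0] by blast
    then show "\<exists>p. normal_seq X (fst p) \<and> 0 \<le> snd p \<and> snd p \<in> fst p 0 \<and> snd p \<notin> U0"
      using V by (intro exI[of _ "(V, x)"]) simp
  next
    fix p and n :: nat
    assume "normal_seq X (fst p) \<and> 0 \<le> snd p \<and> snd p \<in> fst p n \<and> snd p \<notin> U0"
    then have p: "normal_seq X (fst p)" "0 \<le> snd p" by auto
    obtain W where W: "normal_seq X W" "\<forall>k. W k \<subseteq> fst p k"
      "\<forall>z\<in>(\<Inter>k. W k). 0 \<le> z \<and> z \<le> snd p \<longrightarrow> z \<in> U1"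
      using normal_seq_refine_on_interval[OF X Y p(1) U1(2) p(2)] .
    obtain x where "0 \<le> x" "x \<in> W (Suc n)" "x \<notin> U0"
      using pick normal_seqD(1,2)[OF W(1), of "Suc n"] by blast
    then show "\<exists>p'. (normal_seq X (fst p') \<and> 0 \<le> snd p' \<and> snd p' \<in> fst p' (Suc n) \<and> snd p' \<notin> U0) \<and>
      ((\<forall>k. fst p' k \<subseteq> fst p k) \<and> (\<forall>z\<in>(\<Inter>k. fst p' k). 0 \<le> z \<and> z \<le> snd p \<longrightarrow> z \<in> U1))"
      using W by (intro exI[of _ "(W, x)"]) auto
  qed
  then obtain f where f: "\<And>n. (normal_seq X (fst (f n)) \<and> 0 \<le> snd (f n) \<and> snd (f n) \<in> fst (f n) n \<and> snd (f n) \<notin> U0) \<and>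
     ((\<forall>k. fst (f (Suc n)) k \<subseteq> fst (f n) k) \<and> (\<forall>z\<in>(\<Inter>k. fst (f (Suc n)) k). 0 \<le> z \<and> z \<le> snd (f n) \<longrightarrow> z \<in> U1))"
    by blast
  define V x where "V n = fst (f n)" and "x n = snd (f n)" for n
  have V: "normal_seq X (V n)" and x: "0 \<le> x n" "x n \<in> V n n" "x n \<notin> U0" and
    step: "V (Suc n) k \<subseteq> V n k" and
    small: "z \<in> (\<Inter>k. V (Suc n) k) \<Longrightarrow> 0 \<le> z \<Longrightarrow> z \<le> x n \<Longrightarrow> z \<in> U1" for n k z
    using f[of n] unfolding V_def x_def by blast+
  have mono: "V n k \<subseteq> V m k" if "m \<le> n" for m n k
    using step that by (rule lift_Suc_antimono_le)
  define W where "W n = V n n" for n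
  have W: "normal_seq X W"
    unfolding normal_seq_def
  proof (intro allI conjI ballI)
    fix n show "solid (W n)" "zero_nbhd X (W n)" using normal_seqD(1,2)[OF V] by (auto simp: W_def)
    fix a b assume "a \<in> W (Suc n)" "b \<in> W (Suc n)"
    then have "a \<in> V n (Suc n)" "b \<in> V n (Suc n)" using step unfolding W_def by blast+
    then show "a + b \<in> W n" unfolding W_def by (rule normal_seqD(3)[OF V])
  qed
  have N_sub: "(\<Inter>n. W n) \<subseteq> (\<Inter>k. V n k)" for n
  proof
    fix z assume z: "z \<in> (\<Inter>n. W n)"
    show "z \<in> (\<Inter>k. V n k)"
    proof
      fix k
      have "z \<in> V (max n k) (max n k)" using z by (auto simp: W_def)
      then have "z \<in> V n (max n k)" using mono[of n "max n k"] by auto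
      then show "z \<in> V n k" using normal_seq_decreasing[OF V, of k "max n k"] by auto
    qed
  qed
  have "\<exists>q. 0 \<le> q \<and> q \<in> W n \<and> q \<notin> U1 \<and> (\<forall>z\<in>(\<Inter>k. W k). 0 \<le> z \<longrightarrow> inf z q = 0)" for n
  proof -
    obtain p q where pq: "x n = p + q" "0 \<le> p" "0 \<le> q" "p \<in> (\<Inter>k. W k)"
      and "\<forall>z\<in>(\<Inter>k. W k). z \<le> x n \<longrightarrow> z \<le> p" and disj: "\<forall>z\<in>(\<Inter>k. W k). 0 \<le> z \<longrightarrow> inf z q = 0"
      by (rule band_decomp[OF band_Inter_normal_seq[OF X(1) W] x(1)[of n]])
    have "p \<in> U1" using pq N_sub[of "Suc n"] by (intro small[of _ n]) auto
    then have "q \<notin> U1" using U1(3) pq(1) x(3)[of n] by auto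
    moreover have "q \<in> W n" using x(2)[of n] pq normal_seqD(1)[OF W, of n]
      by (auto simp: W_def intro: solidD_nonneg)
    ultimately show ?thesis using pq disj by blast
  qed
  then obtain q where q: "\<And>n. 0 \<le> q n" "\<And>n. q n \<in> W n" "\<And>n. q n \<notin> U1"
    "\<And>n z. z \<in> (\<Inter>k. W k) \<Longrightarrow> 0 \<le> z \<Longrightarrow> inf z (q n) = 0" by metis
  have "limitin Y q 0 (tails UNIV {(m, n). m \<le> n})"
    by (rule uo_Lebesgue_topologyD[OF Y directed_set_nat normal_seq_uo_null[OF X(1) W q(2,1,4)]])
  from limitin_eventually_zero_nbhd[OF this U1(2)]
  show False using q(3) unfolding eventually_tails[OF directed_set_nat] by auto
qed

lemma Hausdorff_uo_Lebesgue_unique: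
  fixes X Y :: "'g::dedekind_complete_vector_lattice topology"
  assumes "uo_Lebesgue_topology X" "Hausdorff_space X" "uo_Lebesgue_topology Y" "Hausdorff_space Y"
  shows "X = Y"
  using assms
  by (intro locally_solid_topology_eqI uo_Lebesgue_imp_locally_solid iffI)
    (auto intro: uo_Lebesgue_zero_nbhd_coarser)

lemma uo_topology_eq:
  fixes X :: "'g::dedekind_complete_vector_lattice topology"
  assumes "uo_Lebesgue_topology X" "Hausdorff_space X"
  shows "uo_topology = X"
  unfolding uo_topology_def using assms by (intro the_equality) (auto intro: Hausdorff_uo_Lebesgue_unique)

section \<open>Unbounded topologies generated by order continuous operators\<close>

text \<open>The initial topology for the maps \<open>x \<mapsto> \<phi> (\<bar>x - c\<bar> \<sqinter> r)\<close>. Admitting all centres \<open>c\<close>, and not only zero,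
makes the topology translation invariant by construction, and convergence to \<open>l\<close> need
only be tested at the centre \<open>l\<close> (\<open>limitin_unbounded_topology\<close>).\<close>

definition unbounded_topology :: "('g::vector_lattice \<Rightarrow> 'a::vector_lattice) set \<Rightarrow> 'a topology \<Rightarrow> 'g topology" where
  "unbounded_topology \<Phi> X = pullback_topology UNIV
     (\<lambda>x. \<lambda>(\<phi>, r, c)\<in>\<Phi> \<times> {0..} \<times> UNIV. \<phi> (inf \<bar>x - c\<bar> r))
     (product_topology (\<lambda>_. X) (\<Phi> \<times> {0..} \<times> UNIV))"

lemma limitin_pullback_topology_UNIV:
  assumes "\<And>x. e x \<in> topspace T"
  shows "limitin (pullback_topology UNIV e T) f l F \<longleftrightarrow> limitin T (\<lambda>a. e (f a)) (e l) F"
  unfolding limitin_def openin_pullback_topology topspace_pullback_topology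
  using assms by auto

context
  fixes X :: "'a::vector_lattice topology" and \<Phi> :: "('g::vector_lattice \<Rightarrow> 'a) set"
  assumes uoX: "uo_Lebesgue_topology X" and linear: "\<And>\<phi>. \<phi> \<in> \<Phi> \<Longrightarrow> linear \<phi>"
    and positive: "\<And>\<phi> x. \<phi> \<in> \<Phi> \<Longrightarrow> 0 \<le> x \<Longrightarrow> 0 \<le> \<phi> x"
begin

private lemma lsX: "locally_solid_topology X"
  using uoX by (rule uo_Lebesgue_imp_locally_solid)

private lemma mono: "\<phi> \<in> \<Phi> \<Longrightarrow> x \<le> y \<Longrightarrow> \<phi> x \<le> \<phi> y"
  using positive[of \<phi> "y - x"] linear_diff[OF linear, of \<phi> y x] by simp

private lemma embedding_in_topspace:
  "(\<lambda>(\<phi>, r, c)\<in>\<Phi> \<times> {0..} \<times> UNIV. \<phi> (inf \<bar>x - c\<bar> r)) \<in> topspace (product_topology (\<lambda>_. X) (\<Phi> \<times> {0..} \<times> UNIV))"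
  by (simp add: topspace_locally_solid[OF lsX] PiE_UNIV_domain)

text \<open>As \<open>\<bar>(a \<sqinter> r) - (b \<sqinter> r)\<bar> \<le> \<bar>a - b\<bar> \<sqinter> r\<close>, convergence at the centre \<open>l\<close> implies convergence at every centre.\<close>

lemma limitin_unbounded_topology:
  "limitin (unbounded_topology \<Phi> X) f l F \<longleftrightarrow> (\<forall>\<phi>\<in>\<Phi>. \<forall>r\<ge>0. limitin X (\<lambda>a. \<phi> (inf \<bar>f a - l\<bar> r)) 0 F)"
    (is "?L \<longleftrightarrow> ?R")
proof -
  have L: "?L \<longleftrightarrow> (\<forall>\<phi>\<in>\<Phi>. \<forall>r\<ge>0. \<forall>c. limitin X (\<lambda>a. \<phi> (inf \<bar>f a - c\<bar> r)) (\<phi> (inf \<bar>l - c\<bar> r)) F)"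
    unfolding unbounded_topology_def limitin_pullback_topology_UNIV[OF embedding_in_topspace]
      limitin_componentwise
    using embedding_in_topspace by auto
  show ?thesis
  proof
    assume ?L
    show ?R
    proof (intro ballI allI impI)
      fix \<phi> and r :: 'g assume \<phi>: "\<phi> \<in> \<Phi>" and r: "0 \<le> r"
      then have "limitin X (\<lambda>a. \<phi> (inf \<bar>f a - l\<bar> r)) (\<phi> (inf \<bar>l - l\<bar> r)) F"
        using \<open>?L\<close> unfolding L by blast
      then show "limitin X (\<lambda>a. \<phi> (inf \<bar>f a - l\<bar> r)) 0 F"
        using r linear_0[OF linear[OF \<phi>]] by (simp add: inf_absorb1)
    qed
  next
    assume R: ?R
    show ?L
      unfolding L
    proof (intro ballI allI impI)
      fix \<phi> and r c :: 'g assume \<phi>: "\<phi> \<in> \<Phi>" and r: "0 \<le> r"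
      have lim: "limitin X (\<lambda>a. \<phi> (inf \<bar>f a - l\<bar> r)) 0 F" using R \<phi> r by blast
      have "\<bar>\<phi> (inf \<bar>f a - c\<bar> r) - \<phi> (inf \<bar>l - c\<bar> r)\<bar> \<le> \<phi> (inf \<bar>f a - l\<bar> r)" for a
      proof -
        let ?d = "inf \<bar>f a - c\<bar> r - inf \<bar>l - c\<bar> r"
        have "\<bar>?d\<bar> \<le> inf \<bar>\<bar>f a - c\<bar> - \<bar>l - c\<bar>\<bar> r"
          using r by (intro abs_inf_diff_le) auto
        also have "\<dots> \<le> inf \<bar>f a - l\<bar> r"
          using abs_triangle_ineq3[of "f a - c" "l - c"] by (intro inf_mono) auto
        finally have d: "?d \<le> inf \<bar>f a - l\<bar> r" "- ?d \<le> inf \<bar>f a - l\<bar> r"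
          by (auto simp: abs_le_iff)
        have "\<phi> ?d \<le> \<phi> (inf \<bar>f a - l\<bar> r)" "\<phi> (- ?d) \<le> \<phi> (inf \<bar>f a - l\<bar> r)"
          by (rule mono[OF \<phi> d(1)], rule mono[OF \<phi> d(2)])
        then have "\<bar>\<phi> ?d\<bar> \<le> \<phi> (inf \<bar>f a - l\<bar> r)"
          by (intro abs_leI) (simp_all only: linear_neg[OF linear[OF \<phi>]])
        then show ?thesis by (simp only: linear_diff[OF linear[OF \<phi>]])
      qed
      then have "limitin X (\<lambda>a. \<phi> (inf \<bar>f a - c\<bar> r) - \<phi> (inf \<bar>l - c\<bar> r)) 0 F"
        by (intro limitin_squeeze_locally_solid[OF lsX lim] always_eventually allI)
          (blast intro: order.trans abs_ge_self)
      then show "limitin X (\<lambda>a. \<phi> (inf \<bar>f a - c\<bar> r)) (\<phi> (inf \<bar>l - c\<bar> r)) F"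
        by (simp only: limitin_offset_locally_solid[OF lsX])
    qed
  qed
qed

lemma topspace_unbounded_topology: "topspace (unbounded_topology \<Phi> X) = UNIV"
  unfolding unbounded_topology_def topspace_pullback_topology using embedding_in_topspace by blast

private lemma limitin_id_atin:
  assumes "topspace Z = UNIV"
  shows "limitin Z (\<lambda>x. x) x (atin Z x)"
  using continuous_map_id[of Z] assms by (simp only: continuous_map_atin id_def UNIV_I)

private lemma continuous_add:
  "continuous_map (prod_topology (unbounded_topology \<Phi> X) (unbounded_topology \<Phi> X)) (unbounded_topology \<Phi> X) (\<lambda>(x, y). x + y)"
  unfolding continuous_map_atin
proof
  let ?Y = "unbounded_topology \<Phi> X" and ?P = "prod_topology (unbounded_topology \<Phi> X) (unbounded_topology \<Phi> X)"
  fix p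
  have "limitin ?P (\<lambda>q. q) p (atin ?P p)"
    by (rule limitin_id_atin) (simp add: topspace_unbounded_topology)
  then have lim: "limitin ?Y fst (fst p) (atin ?P p)" "limitin ?Y snd (snd p) (atin ?P p)"
    by (simp_all add: limitin_pairwise o_def)
  show "limitin ?Y (\<lambda>(x, y). x + y) (case p of (x, y) \<Rightarrow> x + y) (atin ?P p)"
    unfolding limitin_unbounded_topology case_prod_unfold
  proof (intro ballI allI impI)
    fix \<phi> and r :: 'g assume \<phi>: "\<phi> \<in> \<Phi>" and r: "0 \<le> r"
    have "limitin X (\<lambda>q. \<phi> (inf \<bar>fst q - fst p\<bar> r) + \<phi> (inf \<bar>snd q - snd p\<bar> r)) (0 + 0) (atin ?P p)"
      using lim \<phi> r unfolding limitin_unbounded_topology by (intro limitin_add_locally_solid[OF lsX]) auto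
    then show "limitin X (\<lambda>q. \<phi> (inf \<bar>fst q + snd q - (fst p + snd p)\<bar> r)) 0 (atin ?P p)"
      unfolding add_0
    proof (rule limitin_squeeze_nonneg[OF lsX]; (intro always_eventually allI)?)
      fix q :: "'g \<times> 'g"
      show "0 \<le> \<phi> (inf \<bar>fst q + snd q - (fst p + snd p)\<bar> r)" using r by (intro positive[OF \<phi>]) auto
      have "\<bar>fst q + snd q - (fst p + snd p)\<bar> \<le> \<bar>fst q - fst p\<bar> + \<bar>snd q - snd p\<bar>"
        using abs_triangle_ineq[of "fst q - fst p" "snd q - snd p"] by (simp add: algebra_simps)
      then have "inf \<bar>fst q + snd q - (fst p + snd p)\<bar> r \<le> inf (\<bar>fst q - fst p\<bar> + \<bar>snd q - snd p\<bar>) r"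
        by (rule inf_mono) simp
      also have "\<dots> \<le> inf \<bar>fst q - fst p\<bar> r + inf \<bar>snd q - snd p\<bar> r"
        using r by (intro inf_add_le) auto
      finally show "\<phi> (inf \<bar>fst q + snd q - (fst p + snd p)\<bar> r) \<le> \<phi> (inf \<bar>fst q - fst p\<bar> r) + \<phi> (inf \<bar>snd q - snd p\<bar> r)"
        unfolding linear_add[OF linear[OF \<phi>], symmetric] by (rule mono[OF \<phi>])
    qed
  qed
qed

private lemma continuous_scaleR:
  "continuous_map (prod_topology euclideanreal (unbounded_topology \<Phi> X)) (unbounded_topology \<Phi> X) (\<lambda>(c, x). c *\<^sub>R x)"
  unfolding continuous_map_atin
proof
  let ?Y = "unbounded_topology \<Phi> X" and ?P = "prod_topology euclideanreal (unbounded_topology \<Phi> X)"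
  fix p
  have "limitin ?P (\<lambda>q. q) p (atin ?P p)"
    by (rule limitin_id_atin) (simp add: topspace_unbounded_topology)
  then have fst: "(fst \<longlongrightarrow> fst p) (atin ?P p)" and snd: "limitin ?Y snd (snd p) (atin ?P p)"
    by (simp_all add: limitin_pairwise o_def)
  show "limitin ?Y (\<lambda>(c, x). c *\<^sub>R x) (case p of (c, x) \<Rightarrow> c *\<^sub>R x) (atin ?P p)"
    unfolding limitin_unbounded_topology case_prod_unfold
  proof (intro ballI allI impI)
    fix \<phi> and r :: 'g assume \<phi>: "\<phi> \<in> \<Phi>" and r: "0 \<le> r"
    define k where "k = \<bar>fst p\<bar> + 1"
    have bound: "eventually (\<lambda>q. \<bar>fst q\<bar> \<le> k) (atin ?P p)"
      using order_tendstoD(2)[OF tendsto_rabs[OF fst], of k]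
      by (auto simp: k_def elim: eventually_mono)
    have "((\<lambda>q. \<bar>fst q - fst p\<bar>) \<longlongrightarrow> 0) (atin ?P p)"
      using tendsto_rabs[OF tendsto_diff[OF fst tendsto_const[of "fst p"]]] by simp
    then have "limitin X (\<lambda>q. k *\<^sub>R \<phi> (inf \<bar>snd q - snd p\<bar> r) + \<bar>fst q - fst p\<bar> *\<^sub>R \<phi> \<bar>snd p\<bar>)
       (k *\<^sub>R 0 + 0 *\<^sub>R \<phi> \<bar>snd p\<bar>) (atin ?P p)"
      using snd \<phi> r unfolding limitin_unbounded_topology
      by (intro limitin_add_locally_solid[OF lsX] limitin_scaleR_locally_solid[OF lsX]
          limitin_const_locally_solid[OF lsX] tendsto_const) auto
    then show "limitin X (\<lambda>q. \<phi> (inf \<bar>fst q *\<^sub>R snd q - fst p *\<^sub>R snd p\<bar> r)) 0 (atin ?P p)"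
      unfolding scaleR_zero_right scaleR_zero_left add_0
    proof (rule limitin_squeeze_nonneg[OF lsX])
      show "0 \<le> \<phi> (inf \<bar>fst q *\<^sub>R snd q - fst p *\<^sub>R snd p\<bar> r)" for q
        using r by (intro positive[OF \<phi>]) auto
      show "eventually (\<lambda>q. \<phi> (inf \<bar>fst q *\<^sub>R snd q - fst p *\<^sub>R snd p\<bar> r)
         \<le> k *\<^sub>R \<phi> (inf \<bar>snd q - snd p\<bar> r) + \<bar>fst q - fst p\<bar> *\<^sub>R \<phi> \<bar>snd p\<bar>) (atin ?P p)"
        using bound
      proof eventually_elim
        fix q :: "real \<times> 'g" assume q: "\<bar>fst q\<bar> \<le> k"
        have "fst q *\<^sub>R snd q - fst p *\<^sub>R snd p = fst q *\<^sub>R (snd q - snd p) + (fst q - fst p) *\<^sub>R snd p"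
          by (simp add: algebra_simps)
        then have "\<bar>fst q *\<^sub>R snd q - fst p *\<^sub>R snd p\<bar> \<le> \<bar>fst q\<bar> *\<^sub>R \<bar>snd q - snd p\<bar> + \<bar>fst q - fst p\<bar> *\<^sub>R \<bar>snd p\<bar>"
          using abs_triangle_ineq[of "fst q *\<^sub>R (snd q - snd p)" "(fst q - fst p) *\<^sub>R snd p"]
          by (simp add: abs_scaleR_vector_lattice)
        also have "\<dots> \<le> k *\<^sub>R \<bar>snd q - snd p\<bar> + \<bar>fst q - fst p\<bar> *\<^sub>R \<bar>snd p\<bar>"
          using q by (intro add_mono scaleR_right_mono) auto
        finally have "inf \<bar>fst q *\<^sub>R snd q - fst p *\<^sub>R snd p\<bar> r \<le> inf (k *\<^sub>R \<bar>snd q - snd p\<bar> + \<bar>fst q - fst p\<bar> *\<^sub>R \<bar>snd p\<bar>) r"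
          by (rule inf_mono) simp
        also have "\<dots> \<le> inf (k *\<^sub>R \<bar>snd q - snd p\<bar>) r + inf (\<bar>fst q - fst p\<bar> *\<^sub>R \<bar>snd p\<bar>) r"
          using r by (intro inf_add_le scaleR_nonneg_nonneg) (auto simp: k_def)
        also have "\<dots> \<le> k *\<^sub>R inf \<bar>snd q - snd p\<bar> r + \<bar>fst q - fst p\<bar> *\<^sub>R \<bar>snd p\<bar>"
          using r by (intro add_mono inf_scaleR_le) (auto simp: k_def)
        finally have "\<phi> (inf \<bar>fst q *\<^sub>R snd q - fst p *\<^sub>R snd p\<bar> r) \<le> \<phi> \<dots>"
          by (rule mono[OF \<phi>])
        then show "\<phi> (inf \<bar>fst q *\<^sub>R snd q - fst p *\<^sub>R snd p\<bar> r)
          \<le> k *\<^sub>R \<phi> (inf \<bar>snd q - snd p\<bar> r) + \<bar>fst q - fst p\<bar> *\<^sub>R \<phi> \<bar>snd p\<bar>"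
          by (simp add: linear_add[OF linear[OF \<phi>]] linear_scale[OF linear[OF \<phi>]])
      qed
    qed
  qed
qed

text \<open>The solid kernel \<open>V\<close> of \<open>U\<close> is a neighbourhood of zero: otherwise each open neighbourhood \<open>W\<close>
contains some \<open>x W\<close> that dominates a point \<open>y W\<close> outside \<open>U\<close>. The net \<open>x\<close> tends to zero, so the net \<open>y\<close> does,
which contradicts the openness of \<open>U\<close>.\<close>

private lemma solid_base:
  assumes U: "openin (unbounded_topology \<Phi> X) U" "0 \<in> U"
  shows "\<exists>V W. solid V \<and> V \<subseteq> U \<and> openin (unbounded_topology \<Phi> X) W \<and> 0 \<in> W \<and> W \<subseteq> V"
proof -
  let ?Y = "unbounded_topology \<Phi> X"
  define V where "V = {x. \<forall>y. \<bar>y\<bar> \<le> \<bar>x\<bar> \<longrightarrow> y \<in> U}"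
  have V: "solid V" "V \<subseteq> U"
    unfolding solid_def V_def by (blast intro: order.trans)+
  have "\<exists>W. openin ?Y W \<and> 0 \<in> W \<and> W \<subseteq> V"
  proof (rule ccontr)
    assume "\<nexists>W. openin ?Y W \<and> 0 \<in> W \<and> W \<subseteq> V"
    then have "\<exists>x y. x \<in> W \<and> \<bar>y\<bar> \<le> \<bar>x\<bar> \<and> y \<notin> U" if "openin ?Y W" "0 \<in> W" for W
      using that unfolding V_def by blast
    then obtain x y where xy: "\<And>W. openin ?Y W \<Longrightarrow> 0 \<in> W \<Longrightarrow> x W \<in> W \<and> \<bar>y W\<bar> \<le> \<bar>x W\<bar> \<and> y W \<notin> U"
      by metis
    define A where "A = {W. openin ?Y W \<and> 0 \<in> W}"
    define s where "s = {(W, W'). W \<in> A \<and> W' \<in> A \<and> W' \<subseteq> W}"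
    have "W \<inter> W' \<in> A" if "W \<in> A" "W' \<in> A" for W W'
      using that unfolding A_def by auto
    then have s: "directed_set A s"
      unfolding directed_set_def preorder_on_def refl_on_def trans_def s_def using U
      by (auto simp: A_def intro!: bexI[of _ "_ \<inter> _"])
    have limx: "limitin ?Y x 0 (tails A s)"
      unfolding limitin_def topspace_unbounded_topology eventually_tails[OF s]
      using xy by (auto simp: s_def A_def)
    have "limitin ?Y y 0 (tails A s)"
      unfolding limitin_unbounded_topology
    proof (intro ballI allI impI)
      fix \<phi> and r :: 'g assume \<phi>: "\<phi> \<in> \<Phi>" and r: "0 \<le> r"
      then have "limitin X (\<lambda>a. \<phi> (inf \<bar>x a - 0\<bar> r)) 0 (tails A s)"
        using limx unfolding limitin_unbounded_topology by blast
      then show "limitin X (\<lambda>a. \<phi> (inf \<bar>y a - 0\<bar> r)) 0 (tails A s)"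
      proof (rule limitin_squeeze_nonneg[OF lsX])
        show "0 \<le> \<phi> (inf \<bar>y a - 0\<bar> r)" for a using r by (intro positive[OF \<phi>]) auto
        have "\<phi> (inf \<bar>y W - 0\<bar> r) \<le> \<phi> (inf \<bar>x W - 0\<bar> r)" if "W \<in> A" for W
          using xy[of W] that by (intro mono[OF \<phi>] inf_mono) (auto simp: A_def)
        moreover obtain W where "W \<in> A" using U by (auto simp: A_def)
        ultimately show "eventually (\<lambda>W. \<phi> (inf \<bar>y W - 0\<bar> r) \<le> \<phi> (inf \<bar>x W - 0\<bar> r)) (tails A s)"
          unfolding eventually_tails[OF s] by (auto simp: s_def)
      qed
    qed
    then have "eventually (\<lambda>W. y W \<in> U) (tails A s)"
      using U unfolding limitin_def by blast
    then obtain W where "W \<in> A" "\<And>W'. (W, W') \<in> s \<Longrightarrow> y W' \<in> U"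
      unfolding eventually_tails[OF s] by blast
    then show False using xy[of W] by (auto simp: s_def A_def)
  qed
  with V show ?thesis by blast
qed

text \<open>Unbounded order convergence makes \<open>\<bar>x\<^sub>a\<bar> \<sqinter> u\<close> order convergent to zero, and an order continuous map
preserves that.\<close>

lemma uo_Lebesgue_unbounded_topology:
  assumes order_cont: "\<And>\<phi> (B :: 'g set) s y. \<phi> \<in> \<Phi> \<Longrightarrow> decreases_to_zero B s y \<Longrightarrow> decreases_to_zero B s (\<lambda>b. \<phi> (y b))"
  shows "uo_Lebesgue_topology (unbounded_topology \<Phi> X)"
  unfolding uo_Lebesgue_topology_def
proof (intro conjI allI impI)
  show "locally_solid_topology (unbounded_topology \<Phi> X)"
    unfolding locally_solid_topology_def
    using topspace_unbounded_topology continuous_add continuous_scaleR solid_base by blast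
  fix A :: "('g \<times> 'g set) set" and r and x :: "'g \<times> 'g set \<Rightarrow> 'g"
  assume "directed_set A r \<and> uo_conv A r x 0"
  then have A: "directed_set A r" and uo: "uo_conv A r x 0" by auto
  show "limitin (unbounded_topology \<Phi> X) x 0 (tails A r)"
    unfolding limitin_unbounded_topology
  proof (intro ballI allI impI uo_Lebesgue_topologyD[OF uoX A])
    fix \<phi> and u :: 'g assume \<phi>: "\<phi> \<in> \<Phi>" and u: "0 \<le> u"
    then obtain B :: "'g set" and s z where z: "decreases_to_zero B s z"
      and dom: "\<forall>b\<in>B. \<exists>a\<in>A. \<forall>a'. (a, a') \<in> r \<longrightarrow> \<bar>0 - inf \<bar>x a' - 0\<bar> u\<bar> \<le> z b"
      using uo unfolding uo_conv_def order_conv_def by meson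
    show "uo_conv A r (\<lambda>a. \<phi> (inf \<bar>x a - 0\<bar> u)) 0"
      unfolding uo_conv_def
    proof (intro allI impI order_convI[OF order_cont[OF \<phi> z]])
      fix y :: 'a and b assume y: "0 \<le> y" and "b \<in> B"
      then obtain a where a: "a \<in> A" "\<And>a'. (a, a') \<in> r \<Longrightarrow> \<bar>0 - inf \<bar>x a' - 0\<bar> u\<bar> \<le> z b"
        using dom by blast
      have "\<bar>0 - inf \<bar>\<phi> (inf \<bar>x a' - 0\<bar> u) - 0\<bar> y\<bar> \<le> \<phi> (z b)" if "(a, a') \<in> r" for a'
      proof -
        have 0: "0 \<le> inf \<bar>x a' - 0\<bar> u" using u by simp
        then have "inf \<bar>x a' - 0\<bar> u \<le> z b" using a(2)[OF that] by simp
        then have "\<phi> (inf \<bar>x a' - 0\<bar> u) \<le> \<phi> (z b)" by (rule mono[OF \<phi>])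
        then show ?thesis using positive[OF \<phi> 0] y by (simp add: le_infI1)
      qed
      with a(1) show "\<exists>a\<in>A. \<forall>a'. (a, a') \<in> r \<longrightarrow> \<bar>0 - inf \<bar>\<phi> (inf \<bar>x a' - 0\<bar> u) - 0\<bar> y\<bar> \<le> \<phi> (z b)"
        by blast
    qed
  qed
qed

text \<open>The map with centre \<open>y\<close> and truncation at \<open>\<bar>x - y\<bar>\<close> vanishes at \<open>y\<close>; at \<open>x\<close> its value
is \<open>\<phi> \<bar>x - y\<bar>\<close>, which is nonzero for a suitable \<open>\<phi>\<close>.\<close>

lemma Hausdorff_unbounded_topology:
  assumes H: "Hausdorff_space X" and sep: "\<And>x. 0 \<le> x \<Longrightarrow> (\<And>\<phi>. \<phi> \<in> \<Phi> \<Longrightarrow> \<phi> x = 0) \<Longrightarrow> x = 0"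
  shows "Hausdorff_space (unbounded_topology \<Phi> X)"
proof -
  let ?Y = "unbounded_topology \<Phi> X"
  have "\<exists>U V. openin ?Y U \<and> openin ?Y V \<and> x \<in> U \<and> y \<in> V \<and> disjnt U V" if "x \<noteq> y" for x y
  proof -
    have "\<bar>x - y\<bar> \<noteq> 0" using that by simp
    then obtain \<phi> where \<phi>: "\<phi> \<in> \<Phi>" "\<phi> \<bar>x - y\<bar> \<noteq> 0" using sep[of "\<bar>x - y\<bar>"] by auto
    define g where "g z = \<phi> (inf \<bar>z - y\<bar> \<bar>x - y\<bar>)" for z
    have "continuous_map ?Y (product_topology (\<lambda>_. X) (\<Phi> \<times> {0..} \<times> UNIV))
       (\<lambda>x. \<lambda>(\<phi>, r, c)\<in>\<Phi> \<times> {0..} \<times> UNIV. \<phi> (inf \<bar>x - c\<bar> r))"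
      unfolding unbounded_topology_def
      using continuous_map_pullback[OF continuous_map_id, where A = UNIV] by (simp add: o_def)
    then have g: "continuous_map ?Y X g"
      unfolding continuous_map_componentwise g_def using \<phi> by fastforce
    have "g x \<noteq> g y" using \<phi> linear_0[OF linear[OF \<phi>(1)]] by (simp add: g_def inf_absorb1)
    then obtain U V where "openin X U" "openin X V" "g x \<in> U" "g y \<in> V" "disjnt U V"
      using H unfolding Hausdorff_space_def topspace_locally_solid[OF lsX] by blast
    then show ?thesis
      using openin_continuous_map_preimage[OF g, of U] openin_continuous_map_preimage[OF g, of V]
      by (intro exI[of _ "{z. g z \<in> U}"] exI[of _ "{z. g z \<in> V}"])
        (auto simp: topspace_unbounded_topology disjnt_def)
  qed
  then show ?thesis unfolding Hausdorff_space_def by blast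
qed

end

section \<open>Dedekind completeness of the operator lattice\<close>

lemma linear_apply_op: "linear (apply_op T)" and order_bounded_apply_op: "order_bounded (apply_op T)"
  using apply_op[of T] by auto

lemmas apply_op_add [simp] = linear_add[OF linear_apply_op]
  and apply_op_diff [simp] = linear_diff[OF linear_apply_op]
  and apply_op_neg [simp] = linear_neg[OF linear_apply_op]
  and apply_op_zero [simp] = linear_0[OF linear_apply_op]
  and apply_op_scaleR [simp] = linear_scale[OF linear_apply_op]

lemma apply_op_leI: "(\<And>x. 0 \<le> x \<Longrightarrow> apply_op S x \<le> apply_op T x) \<Longrightarrow> S \<le> T"
  by (simp add: less_eq_obop.rep_eq)

lemma apply_op_leD: "S \<le> T \<Longrightarrow> 0 \<le> x \<Longrightarrow> apply_op S x \<le> apply_op T x"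
  by (simp add: less_eq_obop.rep_eq)

lemma apply_op_nonneg: "0 \<le> T \<Longrightarrow> 0 \<le> x \<Longrightarrow> 0 \<le> apply_op T x"
  using apply_op_leD[of 0 T x] by (simp add: zero_obop.rep_eq)

lemma apply_op_mono: "0 \<le> T \<Longrightarrow> x \<le> y \<Longrightarrow> apply_op T x \<le> apply_op T y"
  using apply_op_nonneg[of T "y - x"] by simp

text \<open>Kantorovich's extension lemma. The extension is order bounded because it is positive.\<close>

lemma positive_operator_extension:
  fixes f :: "'a::vector_lattice \<Rightarrow> 'a"
  assumes add: "\<And>x y. 0 \<le> x \<Longrightarrow> 0 \<le> y \<Longrightarrow> f (x + y) = f x + f y"
    and scale: "\<And>c x. 0 \<le> c \<Longrightarrow> 0 \<le> x \<Longrightarrow> f (c *\<^sub>R x) = c *\<^sub>R f x"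
    and pos: "\<And>x. 0 \<le> x \<Longrightarrow> 0 \<le> f x"
  obtains P where "0 \<le> P" "\<forall>x\<ge>0. apply_op P x = f x"
proof -
  define h where "h x = f (pprt x) - f (- nprt x)" for x
  have h_diff: "h (a - b) = f a - f b" if "0 \<le> a" "0 \<le> b" for a b
  proof -
    have "a + - nprt (a - b) = b + pprt (a - b)"
      using prts[of "a - b"] by (simp add: algebra_simps)
    then have "f a + f (- nprt (a - b)) = f b + f (pprt (a - b))"
      using add[of a "- nprt (a - b)"] add[of b "pprt (a - b)"] that by simp
    then show ?thesis by (simp add: h_def algebra_simps)
  qed
  have f0: "f 0 = 0" using scale[of 0 0] by simp
  have h_nonneg: "h x = f x" if "0 \<le> x" for x
    using h_diff[of x 0] that f0 by simp
  have "linear h"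
  proof (rule linearI)
    fix x y :: 'a
    have "x + y = (pprt x + pprt y) - (- nprt x + - nprt y)"
      using arg_cong2[OF prts[of x] prts[of y], of "(+)"] by (simp add: algebra_simps)
    then have "h (x + y) = f (pprt x + pprt y) - f (- nprt x + - nprt y)"
      using h_diff[of "pprt x + pprt y" "- nprt x + - nprt y"]
      by (metis add_nonneg_nonneg neg_0_le_iff_le nprt_le_zero zero_le_pprt)
    then show "h (x + y) = h x + h y"
      using add[of "pprt x" "pprt y"] add[of "- nprt x" "- nprt y"] by (simp add: h_def)
  next
    fix c :: real and x :: 'a
    have x: "x = pprt x - (- nprt x)" using prts[of x] by simp
    show "h (c *\<^sub>R x) = c *\<^sub>R h x"
    proof (cases "0 \<le> c")
      case True
      have "c *\<^sub>R x = c *\<^sub>R pprt x - c *\<^sub>R (- nprt x)" using x by (metis scaleR_diff_right)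
      then have "h (c *\<^sub>R x) = f (c *\<^sub>R pprt x) - f (c *\<^sub>R (- nprt x))"
        using h_diff[of "c *\<^sub>R pprt x" "c *\<^sub>R (- nprt x)"] True
        by (metis scaleR_nonneg_nonneg neg_0_le_iff_le nprt_le_zero zero_le_pprt)
      also have "\<dots> = c *\<^sub>R f (pprt x) - c *\<^sub>R f (- nprt x)"
        using scale[of c "pprt x"] scale[of c "- nprt x"] True by simp
      finally show ?thesis by (simp add: h_def algebra_simps)
    next
      case False
      have "c *\<^sub>R x = (- c) *\<^sub>R (- nprt x) - (- c) *\<^sub>R pprt x" using x
        by (metis minus_diff_eq scaleR_diff_right scaleR_minus_left)
      then have "h (c *\<^sub>R x) = f ((- c) *\<^sub>R (- nprt x)) - f ((- c) *\<^sub>R pprt x)"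
        using h_diff[of "(- c) *\<^sub>R (- nprt x)" "(- c) *\<^sub>R pprt x"] False
        by (metis scaleR_nonneg_nonneg neg_0_le_iff_le nprt_le_zero zero_le_pprt linear not_le)
      also have "\<dots> = (- c) *\<^sub>R f (- nprt x) - (- c) *\<^sub>R f (pprt x)"
        using scale[of "- c" "pprt x"] scale[of "- c" "- nprt x"] False by simp
      finally show ?thesis by (simp add: h_def algebra_simps)
    qed
  qed
  moreover from this have "order_bounded h"
    by (rule order_bounded_positive) (simp add: h_nonneg pos)
  ultimately have "apply_op (Abs_obop h) = h" by (simp add: Abs_obop_inverse)
  then show thesis
    by (intro that[of "Abs_obop h"] apply_op_leI) (simp_all add: h_nonneg pos zero_obop.rep_eq)
qed

text \<open>The pointwise infimum is additive because the set is directed: two operators, one evaluated at each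
summand, may be replaced by a common smaller one.\<close>

lemma directed_Inf_operator:
  fixes D :: "'a::dedekind_complete_vector_lattice obop set"
  assumes D: "D \<noteq> {}" and dir: "\<And>S T. S \<in> D \<Longrightarrow> T \<in> D \<Longrightarrow> \<exists>R\<in>D. R \<le> S \<and> R \<le> T"
    and pos: "\<And>T. T \<in> D \<Longrightarrow> 0 \<le> T"
  obtains P where "0 \<le> P" "\<forall>x\<ge>0. apply_op P x = (INF T\<in>D. apply_op T x)"
proof -
  define f where "f x = (INF T\<in>D. apply_op T x)" for x
  have bdd: "bdd_below ((\<lambda>T. apply_op T x) ` D)" if "0 \<le> x" for x
    using pos apply_op_nonneg that by (intro bdd_belowI[of _ 0]) auto
  have lower: "f x \<le> apply_op T x" if "0 \<le> x" "T \<in> D" for x T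
    unfolding f_def using bdd that by (intro cINF_lower)
  have greatest: "z \<le> f x" if "\<And>T. T \<in> D \<Longrightarrow> z \<le> apply_op T x" for x z
    unfolding f_def using D that by (intro cINF_greatest)
  show thesis
  proof (rule positive_operator_extension[of f])
    fix x y :: 'a assume x: "0 \<le> x" and y: "0 \<le> y"
    show "f (x + y) = f x + f y"
    proof (rule order.antisym)
      have "f (x + y) - apply_op T y \<le> f x" if T: "T \<in> D" for T
      proof (rule greatest)
        fix S assume "S \<in> D"
        then obtain R where R: "R \<in> D" "R \<le> S" "R \<le> T" using dir T by blast
        have "f (x + y) \<le> apply_op R (x + y)" using x y R by (intro lower) auto
        also have "\<dots> \<le> apply_op S x + apply_op T y"
          using R x y by (simp add: add_mono apply_op_leD)
        finally show "f (x + y) - apply_op T y \<le> apply_op S x" by (simp add: algebra_simps)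
      qed
      then have "f (x + y) - f x \<le> f y" by (intro greatest) (simp add: algebra_simps)
      then show "f (x + y) \<le> f x + f y" by (simp add: algebra_simps)
      show "f x + f y \<le> f (x + y)"
        using lower x y by (intro greatest) (simp add: add_mono)
    qed
  next
    fix c :: real and x :: 'a assume c: "0 \<le> c" and x: "0 \<le> x"
    have le: "k *\<^sub>R f z \<le> f (k *\<^sub>R z)" if "0 \<le> k" "0 \<le> z" for k z
      using that lower by (intro greatest) (simp add: scaleR_left_mono)
    show "f (c *\<^sub>R x) = c *\<^sub>R f x"
    proof (cases "c = 0")
      case True
      obtain T where "T \<in> D" using D by blast
      then have "f 0 = 0" using lower[of 0 T] greatest[of 0 0] by (intro order.antisym) auto
      with True show ?thesis by simp
    next
      case False
      then have c: "0 < c" using c by simp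
      have "c *\<^sub>R (inverse c *\<^sub>R f (c *\<^sub>R x)) \<le> c *\<^sub>R f (inverse c *\<^sub>R (c *\<^sub>R x))"
        using c x by (intro scaleR_left_mono le scaleR_nonneg_nonneg) auto
      then have "f (c *\<^sub>R x) \<le> c *\<^sub>R f x" using c by simp
      then show ?thesis using le[of c x] c x by (intro order.antisym) auto
    qed
  next
    fix x :: 'a assume "0 \<le> x"
    then show "0 \<le> f x" using pos apply_op_nonneg by (intro greatest) auto
  next
    fix P :: "'a obop" assume "0 \<le> P" "\<forall>x\<ge>0. apply_op P x = f x"
    then show thesis unfolding f_def by (rule that)
  qed
qed

lemma directed_Inf_operator_greatest:
  fixes D :: "'a::dedekind_complete_vector_lattice obop set"
  assumes D: "D \<noteq> {}" and dir: "\<And>S T. S \<in> D \<Longrightarrow> T \<in> D \<Longrightarrow> \<exists>R\<in>D. R \<le> S \<and> R \<le> T"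
    and pos: "\<And>T. T \<in> D \<Longrightarrow> 0 \<le> T"
  obtains P where "0 \<le> P" "\<forall>T\<in>D. P \<le> T" "\<forall>Q. (\<forall>T\<in>D. Q \<le> T) \<longrightarrow> Q \<le> P"
    "\<forall>x\<ge>0. \<forall>z. (\<forall>T\<in>D. z \<le> apply_op T x) \<longrightarrow> z \<le> apply_op P x"
proof -
  obtain P where P: "0 \<le> P" "\<forall>x\<ge>0. apply_op P x = (INF T\<in>D. apply_op T x)"
    using directed_Inf_operator[OF D dir pos] by metis
  have bdd: "bdd_below ((\<lambda>T. apply_op T x) ` D)" if "0 \<le> x" for x
    using pos apply_op_nonneg that by (intro bdd_belowI[of _ 0]) auto
  show thesis
  proof (rule that[OF P(1)])
    show "\<forall>T\<in>D. P \<le> T"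
      using P(2) bdd by (auto intro!: apply_op_leI cINF_lower)
    show pointwise: "\<forall>x\<ge>0. \<forall>z. (\<forall>T\<in>D. z \<le> apply_op T x) \<longrightarrow> z \<le> apply_op P x"
      using P(2) D by (auto intro!: cINF_greatest)
    show "\<forall>Q. (\<forall>T\<in>D. Q \<le> T) \<longrightarrow> Q \<le> P"
      using pointwise by (auto intro!: apply_op_leI dest: apply_op_leD)
  qed
qed

text \<open>The upper bounds of \<open>D\<close> form a set directed downwards, so after a shift by an element of \<open>D\<close>
their infimum may be taken pointwise.\<close>

lemma operator_lub_exists:
  fixes D :: "'a::dedekind_complete_vector_lattice obop set"
  assumes "D \<noteq> {}" "bdd_above D"
  shows "\<exists>L. (\<forall>T\<in>D. T \<le> L) \<and> (\<forall>U. (\<forall>T\<in>D. T \<le> U) \<longrightarrow> L \<le> U)"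
proof -
  obtain T0 where T0: "T0 \<in> D" using assms by blast
  let ?E = "{U - T0 | U. \<forall>T\<in>D. T \<le> U}"
  obtain P where P: "0 \<le> P" "\<forall>T\<in>?E. P \<le> T" "\<forall>Q. (\<forall>T\<in>?E. Q \<le> T) \<longrightarrow> Q \<le> P"
    "\<forall>x\<ge>0. \<forall>z. (\<forall>T\<in>?E. z \<le> apply_op T x) \<longrightarrow> z \<le> apply_op P x"
  proof (rule directed_Inf_operator_greatest[of ?E])
    show "?E \<noteq> {}" using assms(2) unfolding bdd_above_def by blast
    fix S T assume "S \<in> ?E" "T \<in> ?E"
    then obtain U V where "S = U - T0" "\<forall>T\<in>D. T \<le> U" "T = V - T0" "\<forall>T\<in>D. T \<le> V" by blast
    then show "\<exists>R\<in>?E. R \<le> S \<and> R \<le> T"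
      by (intro bexI[of _ "inf U V - T0"]) auto
  next
    fix T assume "T \<in> ?E" then show "0 \<le> T" using T0 by auto
  qed
  have "T \<le> P + T0" if "T \<in> D" for T
  proof -
    have "\<forall>R\<in>?E. T - T0 \<le> R" using that by auto
    then have "T - T0 \<le> P" using P(3) by blast
    then show ?thesis by (simp add: algebra_simps)
  qed
  moreover have "P + T0 \<le> U" if "\<forall>T\<in>D. T \<le> U" for U
  proof -
    have "P \<le> U - T0" using P(2) that by blast
    then show ?thesis by (simp add: algebra_simps)
  qed
  ultimately show ?thesis by blast
qed

instantiation obop :: (dedekind_complete_vector_lattice) dedekind_complete_vector_lattice
begin

definition Sup_obop :: "'a obop set \<Rightarrow> 'a obop" where
  "Sup_obop D = (SOME L. (\<forall>T\<in>D. T \<le> L) \<and> (\<forall>U. (\<forall>T\<in>D. T \<le> U) \<longrightarrow> L \<le> U))"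

definition Inf_obop :: "'a obop set \<Rightarrow> 'a obop" where
  "Inf_obop D = - Sup (uminus ` D)"

instance
proof
  have *: "(\<forall>T\<in>D. T \<le> Sup D) \<and> (\<forall>U. (\<forall>T\<in>D. T \<le> U) \<longrightarrow> Sup D \<le> U)"
    if "D \<noteq> {}" "bdd_above D" for D :: "'a obop set"
    unfolding Sup_obop_def by (rule someI_ex[OF operator_lub_exists[OF that]])
  fix T U :: "'a obop" and D :: "'a obop set"
  show "T \<le> Sup D" if "T \<in> D" "bdd_above D" using *[of D] that by blast
  show "Sup D \<le> U" if "D \<noteq> {}" "\<And>T. T \<in> D \<Longrightarrow> T \<le> U"
    using *[of D] that by (meson bdd_above.I)
  show "Inf D \<le> T" if T: "T \<in> D" "bdd_below D"
  proof -
    obtain m where "\<And>T. T \<in> D \<Longrightarrow> m \<le> T" using T(2) unfolding bdd_below_def by blast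
    then have "bdd_above (uminus ` D)" by (intro bdd_aboveI[of _ "- m"]) auto
    then have "- T \<le> Sup (uminus ` D)" using *[of "uminus ` D"] T by blast
    then have "- Sup (uminus ` D) \<le> - (- T)" by (simp only: neg_le_iff_le)
    then show ?thesis by (simp add: Inf_obop_def)
  qed
  show "U \<le> Inf D" if "D \<noteq> {}" "\<And>T. T \<in> D \<Longrightarrow> U \<le> T"
  proof -
    have le: "S \<le> - U" if "S \<in> uminus ` D" for S using that \<open>\<And>T. T \<in> D \<Longrightarrow> U \<le> T\<close> by auto
    then have "bdd_above (uminus ` D)" by (rule bdd_aboveI)
    then have "Sup (uminus ` D) \<le> - U" using *[of "uminus ` D"] that(1) le by blast
    then have "- (- U) \<le> - Sup (uminus ` D)" by (simp only: neg_le_iff_le)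
    then show ?thesis by (simp add: Inf_obop_def)
  qed
qed

end

lemma evaluation_order_continuous:
  fixes y :: "'i \<Rightarrow> 'a::dedekind_complete_vector_lattice obop"
  assumes y: "decreases_to_zero B s y" and x: "0 \<le> x"
  shows "decreases_to_zero B s (\<lambda>b. apply_op (y b) x)"
proof -
  have dir: "directed_set B s" and mono: "\<And>b c. (b, c) \<in> s \<Longrightarrow> y c \<le> y b" and pos: "\<And>b. b \<in> B \<Longrightarrow> 0 \<le> y b"
    and glb: "\<And>z. (\<And>b. b \<in> B \<Longrightarrow> z \<le> y b) \<Longrightarrow> z \<le> 0"
    using y unfolding decreases_to_zero_def by auto
  obtain P where P: "0 \<le> P" "\<forall>T\<in>y ` B. P \<le> T" "\<forall>Q. (\<forall>T\<in>y ` B. Q \<le> T) \<longrightarrow> Q \<le> P"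
    "\<forall>x\<ge>0. \<forall>z. (\<forall>T\<in>y ` B. z \<le> apply_op T x) \<longrightarrow> z \<le> apply_op P x"
  proof (rule directed_Inf_operator_greatest[of "y ` B"])
    show "y ` B \<noteq> {}" using dir by (auto simp: directed_set_def)
    show "\<exists>R\<in>y ` B. R \<le> S \<and> R \<le> T" if ST: "S \<in> y ` B" "T \<in> y ` B" for S T
    proof -
      obtain b c where bc: "b \<in> B" "S = y b" "c \<in> B" "T = y c" using ST by blast
      then obtain d where "d \<in> B" "(b, d) \<in> s" "(c, d) \<in> s"
        using dir unfolding directed_set_def by blast
      then show ?thesis using bc mono by blast
    qed
    show "0 \<le> T" if "T \<in> y ` B" for T using pos that by blast
  qed
  have "P \<le> 0" using P(2) by (intro glb) auto
  then have "P = 0" using P(1) by simp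
  then have "z \<le> 0" if "\<forall>b\<in>B. z \<le> apply_op (y b) x" for z
    using P(4) x that by (simp add: zero_obop.rep_eq)
  then show ?thesis
    unfolding decreases_to_zero_def using dir x by (auto simp: mono pos apply_op_leD apply_op_nonneg)
qed

section \<open>Orthomorphisms\<close>

lemma apply_op_uminus [simp]: "apply_op (- T) x = - apply_op T x"
  and apply_op_minus [simp]: "apply_op (S - T) x = apply_op S x - apply_op T x"
  and apply_op_plus [simp]: "apply_op (S + T) x = apply_op S x + apply_op T x"
  by (simp_all add: uminus_obop.rep_eq minus_obop.rep_eq plus_obop.rep_eq)

lemma abs_apply_op_le:
  fixes T :: "'a::dedekind_complete_vector_lattice obop"
  shows "\<bar>apply_op T x\<bar> \<le> apply_op \<bar>T\<bar> \<bar>x\<bar>"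
proof -
  have *: "apply_op S x \<le> apply_op \<bar>T\<bar> \<bar>x\<bar>" if S: "S \<le> \<bar>T\<bar>" "- S \<le> \<bar>T\<bar>" for S
  proof -
    have "apply_op S x = apply_op S (pprt x) + apply_op (- S) (- nprt x)"
      using arg_cong[OF prts[of x], of "apply_op S"] by simp
    also have "\<dots> \<le> apply_op \<bar>T\<bar> (pprt x) + apply_op \<bar>T\<bar> (- nprt x)"
      using S by (intro add_mono apply_op_leD) auto
    also have "\<dots> = apply_op \<bar>T\<bar> \<bar>x\<bar>"
      by (simp add: abs_prts)
    finally show ?thesis .
  qed
  show ?thesis
    using *[of T] *[of "- T"] by (intro abs_leI) (auto intro: abs_ge_self abs_ge_minus_self)
qed

lemma apply_op_sup_nonneg:
  "0 \<le> x \<Longrightarrow> apply_op (sup S T) x = rk_sup (apply_op S) (apply_op T) x"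
  by (simp add: sup_obop.rep_eq rk_sup_zero linear_apply_op order_bounded_apply_op)

lemma bandD:
  assumes "band B"
  shows "subspace B" "solid B" "D \<subseteq> B \<Longrightarrow> D \<noteq> {} \<Longrightarrow> bdd_above D \<Longrightarrow> Sup D \<in> B"
  using assms unfolding band_def by blast+

lemma OrthD: "T \<in> Orth \<Longrightarrow> band B \<Longrightarrow> x \<in> B \<Longrightarrow> apply_op T x \<in> B"
  unfolding Orth_def by blast

lemma OrthI: "(\<And>B x. band B \<Longrightarrow> x \<in> B \<Longrightarrow> apply_op T x \<in> B) \<Longrightarrow> T \<in> Orth"
  unfolding Orth_def by blast

lemma Orth_diff: "S \<in> Orth \<Longrightarrow> T \<in> Orth \<Longrightarrow> S - T \<in> Orth"
  by (intro OrthI) (auto intro: subspace_diff bandD(1) OrthD)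

lemma Orth_scaleR: "T \<in> Orth \<Longrightarrow> c *\<^sub>R T \<in> Orth"
  by (intro OrthI) (auto simp: scaleR_obop.rep_eq intro: subspace_scale bandD(1) OrthD)

lemma Orth_compose: "S \<in> Orth \<Longrightarrow> T \<in> Orth \<Longrightarrow> S \<circ>\<^sub>o T \<in> Orth"
  by (intro OrthI) (auto simp: compose_op.rep_eq intro: OrthD)

text \<open>By the Riesz-Kantorovich formula \<open>\<bar>T\<bar> u\<close> is a supremum of elements \<open>T y - T (u - y)\<close> of the band.\<close>

lemma Orth_abs:
  assumes T: "T \<in> Orth"
  shows "\<bar>T\<bar> \<in> Orth"
proof (rule OrthI)
  fix B :: "'a set" and x assume B: "band B" and x: "x \<in> B"
  note B' = bandD[OF B]
  have *: "apply_op \<bar>T\<bar> u \<in> B" if u: "0 \<le> u" "u \<in> B" for u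
  proof -
    let ?D = "(\<lambda>y. apply_op T y + apply_op (- T) (u - y)) ` {0..u}"
    have "apply_op \<bar>T\<bar> u = Sup ?D"
      unfolding abs_obop_def apply_op_sup_nonneg[OF u(1)] rk_sup_def ..
    moreover have "Sup ?D \<in> B"
    proof (rule B'(3))
      show "?D \<noteq> {}" using u by auto
      show "bdd_above ?D"
      proof (rule bdd_aboveI)
        fix z assume "z \<in> ?D"
        then obtain y where y: "0 \<le> y" "y \<le> u" "z = apply_op T y + apply_op (- T) (u - y)"
          by (auto simp del: apply_op_uminus apply_op_diff)
        show "z \<le> rk_sup (apply_op T) (apply_op (- T)) u"
          unfolding y(3)
          by (rule rk_sup_upper[OF linear_apply_op order_bounded_apply_op linear_apply_op order_bounded_apply_op y(1,2)])
      qed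
      show "?D \<subseteq> B"
      proof (rule image_subsetI)
        fix y assume "y \<in> {0..u}"
        then have "y \<in> B" "u - y \<in> B"
          using u(2) by (auto intro: solidD_nonneg[OF B'(2)])
        then have "apply_op T y \<in> B" "apply_op T (u - y) \<in> B"
          using OrthD[OF T B] by blast+
        then show "apply_op T y + apply_op (- T) (u - y) \<in> B"
          using subspace_diff[OF B'(1)] by (simp del: apply_op_diff)
      qed
    qed
    ultimately show ?thesis by simp
  qed
  have "\<bar>x\<bar> \<in> B" using solidD[OF B'(2) x] by simp
  then have "apply_op \<bar>T\<bar> \<bar>x\<bar> \<in> B" by (intro *) auto
  moreover have "\<bar>apply_op \<bar>T\<bar> x\<bar> \<le> \<bar>apply_op \<bar>T\<bar> \<bar>x\<bar>\<bar>"
    using abs_apply_op_le[of "\<bar>T\<bar>" x] by (auto intro: order.trans abs_ge_self)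
  ultimately show "apply_op \<bar>T\<bar> x \<in> B" by (rule solidD[OF B'(2)])
qed

lemma Orth_dominated:
  assumes T: "T \<in> Orth" and le: "\<bar>S\<bar> \<le> \<bar>T\<bar>"
  shows "S \<in> Orth"
proof (rule OrthI)
  fix B :: "'a set" and x assume B: "band B" and x: "x \<in> B"
  have "\<bar>x\<bar> \<in> B" using solidD[OF bandD(2)[OF B] x] by simp
  then have "apply_op \<bar>T\<bar> \<bar>x\<bar> \<in> B" using OrthD[OF Orth_abs[OF T] B] by blast
  moreover have "\<bar>apply_op S x\<bar> \<le> \<bar>apply_op \<bar>T\<bar> \<bar>x\<bar>\<bar>"
    using abs_apply_op_le[of S x] apply_op_leD[OF le abs_ge_zero[of x]]
    by (meson abs_ge_self order.trans)
  ultimately show "apply_op S x \<in> B" by (rule solidD[OF bandD(2)[OF B]])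
qed

lemma Orth_disjoint:
  assumes T: "T \<in> Orth" and x: "0 \<le> x" and w: "0 \<le> w" and disj: "inf x w = 0"
  shows "inf \<bar>apply_op T x\<bar> w = 0"
  using OrthD[OF T band_disjoint_complement[OF w], of x] x disj by simp

lemma Orth_disjoint_nonneg:
  assumes "T \<in> Orth" "0 \<le> T" "0 \<le> x" "0 \<le> w" "inf x w = 0"
  shows "inf (apply_op T x) w = 0"
  using Orth_disjoint[of T x w] assms by (simp add: apply_op_nonneg)

text \<open>For multiplication operators this is clear, even with the factor 1. In general \<open>(A \<sqinter> B) x\<close> is the
infimum of \<open>A z + B (x - z)\<close> over \<open>0 \<le> z \<le> x\<close>, and the factor 2 has a simple reason: where
\<open>z \<ge> x / 2\<close> the first summand is at least \<open>A x / 2\<close>, and elsewhere the second one is at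
least \<open>B x / 2\<close>. The two regions are represented by the disjoint positive and negative parts
of \<open>x - 2 z\<close>.\<close>

lemma Orth_inf_apply_le:
  assumes A: "A \<in> Orth" "0 \<le> A" and B: "B \<in> Orth" "0 \<le> B" and x: "0 \<le> x"
  shows "inf (apply_op A x) (apply_op B x) \<le> 2 *\<^sub>R apply_op (inf A B) x"
proof -
  let ?w = "inf (apply_op A x) (apply_op B x)"
  have *: "?w \<le> 2 *\<^sub>R (apply_op A z + apply_op B (x - z))" if z: "0 \<le> z" "z \<le> x" for z
  proof -
    let ?g = "2 *\<^sub>R (apply_op A z + apply_op B (x - z))"
    \<comment> \<open>Both \<open>A d\<^sup>+\<close> and \<open>B d\<^sup>-\<close> dominate the excess of \<open>?w\<close> over \<open>?g\<close>, and they are disjoint.\<close>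
    define d where "d = x - 2 *\<^sub>R z"
    have disj: "inf (pprt d) (- nprt d) = 0" by (rule inf_pprt_nprt)
    then have "inf (apply_op A (pprt d)) (- nprt d) = 0"
      using A by (intro Orth_disjoint_nonneg) auto
    then have "inf (apply_op B (- nprt d)) (apply_op A (pprt d)) = 0"
      using A B by (intro Orth_disjoint_nonneg) (auto simp: inf_commute apply_op_nonneg)
    moreover have "pprt (?w - ?g) \<le> apply_op A (pprt d)"
    proof -
      have "?w - ?g \<le> apply_op A x - 2 *\<^sub>R apply_op A z"
        using x z apply_op_nonneg[OF B(2), of "x - z"]
        by (intro diff_mono) (simp_all add: algebra_simps scaleR_nonneg_nonneg del: apply_op_diff)
      also have "\<dots> = apply_op A d" by (simp add: d_def)
      also have "\<dots> \<le> apply_op A (pprt d)" by (intro apply_op_mono A) (simp add: pprt_def)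
      finally show ?thesis using apply_op_nonneg[OF A(2), of "pprt d"] by (simp add: pprt_def)
    qed
    moreover have "pprt (?w - ?g) \<le> apply_op B (- nprt d)"
    proof -
      have "?w - ?g \<le> apply_op B x - 2 *\<^sub>R apply_op B (x - z)"
        using x z apply_op_nonneg[OF A(2), of z]
        by (intro diff_mono) (simp_all add: algebra_simps scaleR_nonneg_nonneg del: apply_op_diff)
      also have "\<dots> = apply_op B (- d)" by (simp add: d_def algebra_simps scaleR_2)
      also have "\<dots> \<le> apply_op B (- nprt d)" by (intro apply_op_mono B) (simp add: nprt_def)
      finally show ?thesis using apply_op_nonneg[OF B(2), of "- nprt d"] by (simp add: pprt_def)
    qed
    ultimately have "pprt (?w - ?g) \<le> 0" by (metis inf_greatest)
    then have "pprt (?w - ?g) = 0" by (intro order.antisym) auto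
    then show ?thesis by (simp flip: le_zero_iff_zero_pprt)
  qed
  have "rk_sup (apply_op (- A)) (apply_op (- B)) x \<le> - ((1/2) *\<^sub>R ?w)"
  proof (rule rk_sup_least[OF linear_apply_op order_bounded_apply_op linear_apply_op order_bounded_apply_op x])
    fix z assume "0 \<le> z" "z \<le> x"
    then have "(1/2) *\<^sub>R ?w \<le> (1/2) *\<^sub>R (2 *\<^sub>R (apply_op A z + apply_op B (x - z)))"
      by (intro scaleR_left_mono *) auto
    then have "(1/2) *\<^sub>R ?w \<le> apply_op A z + apply_op B (x - z)" by simp
    then have "- (apply_op A z + apply_op B (x - z)) \<le> - ((1/2) *\<^sub>R ?w)" by (simp only: neg_le_iff_le)
    then show "apply_op (- A) z + apply_op (- B) (x - z) \<le> - ((1/2) *\<^sub>R ?w)" by simp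
  qed
  then have "(1/2) *\<^sub>R ?w \<le> apply_op (inf A B) x"
    unfolding inf_obop_def apply_op_uminus apply_op_sup_nonneg[OF x] by (simp add: le_minus_iff)
  then have "2 *\<^sub>R ((1/2) *\<^sub>R ?w) \<le> 2 *\<^sub>R apply_op (inf A B) x" by (rule scaleR_left_mono) simp
  then show ?thesis by simp
qed

text \<open>The positive and the negative part of \<open>T\<close> are disjoint orthomorphisms, so their values at \<open>x\<close> are
disjoint by \<open>Orth_inf_apply_le\<close>.\<close>

lemma Orth_abs_apply:
  assumes T: "T \<in> Orth" and x: "0 \<le> x"
  shows "apply_op \<bar>T\<bar> x = \<bar>apply_op T x\<bar>"
proof -
  let ?P = "pprt T" and ?N = "- nprt T"
  have abs: "\<bar>T\<bar> = ?P + ?N" by (simp add: abs_prts)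
  have "\<bar>?P\<bar> \<le> \<bar>T\<bar>" "\<bar>?N\<bar> \<le> \<bar>T\<bar>" unfolding abs by (simp_all add: add_increasing add_increasing2)
  then have Orth: "?P \<in> Orth" "?N \<in> Orth" using Orth_dominated[OF T] by blast+
  have "inf (apply_op ?P x) (apply_op ?N x) \<le> 2 *\<^sub>R apply_op (inf ?P ?N) x"
    by (rule Orth_inf_apply_le[OF Orth(1) _ Orth(2) _ x]) simp_all
  also have "\<dots> = 0" by (simp add: inf_pprt_nprt zero_obop.rep_eq)
  finally have le: "inf (apply_op ?P x) (apply_op ?N x) \<le> 0" .
  have pos: "0 \<le> apply_op ?P x" "0 \<le> apply_op ?N x" using x by (auto intro!: apply_op_nonneg simp del: apply_op_uminus)
  then have "inf (apply_op ?P x) (apply_op ?N x) = 0"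
    using le by (intro order.antisym) (auto simp del: apply_op_uminus)
  then have "apply_op ?P x + apply_op ?N x = \<bar>apply_op ?P x - apply_op ?N x\<bar>"
    using two_inf_eq[of "apply_op ?P x" "apply_op ?N x"] by simp
  also have "apply_op ?P x - apply_op ?N x = apply_op T x"
    using arg_cong[OF prts[of T], of "\<lambda>T. apply_op T x"] by simp
  finally show ?thesis unfolding abs by simp
qed

text \<open>Split \<open>y = (y \<sqinter> w) + (y - w)\<^sup>+\<close>. The first part contributes at most \<open>A w\<close>. The second one is mapped into
the region where \<open>y > w\<close>, and there the truncation at \<open>w\<close> is below \<open>y\<close>.\<close>

lemma Orth_inf_le_add:
  assumes A: "A \<in> Orth" "0 \<le> A" and y: "0 \<le> y" and w: "0 \<le> w"
  shows "inf (apply_op A y) w \<le> apply_op A w + y"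
proof -
  let ?v = "inf (apply_op A (pprt (y - w))) w"
  have "pprt (y - w) + inf y w = y"
    using add_inf_distrib_left[of "- w" y w] prts[of "y - w"] by (simp add: nprt_def algebra_simps)
  then have "apply_op A y = apply_op A (inf y w) + apply_op A (pprt (y - w))"
    by (metis add.commute apply_op_add)
  then have "inf (apply_op A y) w \<le> inf (apply_op A (inf y w)) w + ?v"
    using inf_add_le[of "apply_op A (inf y w)" "apply_op A (pprt (y - w))" w] A y w by (simp add: apply_op_nonneg)
  moreover have "inf (apply_op A (inf y w)) w \<le> apply_op A w"
    by (rule le_infI1) (simp add: apply_op_mono A)
  moreover have "?v \<le> y"
  proof -
    have "inf (apply_op A (pprt (y - w))) (- nprt (y - w)) = 0"
      using A by (intro Orth_disjoint_nonneg inf_pprt_nprt) auto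
    moreover have "pprt (?v - y) \<le> apply_op A (pprt (y - w))"
    proof -
      have "?v - y \<le> apply_op A (pprt (y - w)) - 0" using y by (intro diff_mono) auto
      then show ?thesis using apply_op_nonneg[OF A(2), of "pprt (y - w)"] by (simp add: pprt_def)
    qed
    moreover have "pprt (?v - y) \<le> - nprt (y - w)"
    proof -
      have "pprt (?v - y) \<le> pprt (w - y)" by (intro pprt_mono diff_mono) auto
      also have "\<dots> = - nprt (y - w)" using pprt_neg[of "y - w"] by simp
      finally show ?thesis .
    qed
    ultimately have "pprt (?v - y) \<le> 0" by (metis inf_greatest)
    then have "pprt (?v - y) = 0" by (intro order.antisym) auto
    then show ?thesis by (simp flip: le_zero_iff_zero_pprt)
  qed
  ultimately show ?thesis by (meson add_mono order.trans)
qed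

section \<open>Convergence of orthomorphisms\<close>

lift_definition id_op :: "'a::vector_lattice obop" is "\<lambda>x. x"
  by (auto simp: linear_id[unfolded id_def] intro: order_bounded_positive)

lemma id_op_Orth: "id_op \<in> Orth" and id_op_nonneg: "0 \<le> id_op"
  by (auto simp: Orth_def id_op.rep_eq zero_obop.rep_eq intro: apply_op_leI)

lemma tails_neq_bot:
  assumes "directed_set A r"
  shows "tails A r \<noteq> bot"
  using assms unfolding trivial_limit_def eventually_tails[OF assms]
  by (auto simp: directed_set_def preorder_on_def refl_on_def)

lemma eventually_tails_member:
  assumes A: "directed_set A r" and P: "\<forall>a\<in>A. P a"
  shows "eventually P (tails A r)"
proof -
  have "A \<noteq> {}" "r \<subseteq> A \<times> A" using A by (auto simp: directed_set_def preorder_on_def)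
  then show ?thesis unfolding eventually_tails[OF A] using P by blast
qed

lemma filterlim_tails_fst:
  assumes "directed_set A r" "directed_set B s"
  shows "filterlim fst (tails A r) (tails (A \<times> B) (product_rel r s))"
  unfolding filterlim_iff eventually_tails[OF assms(1)] eventually_tails[OF directed_set_product[OF assms]]
  using assms(2) by (fastforce simp: product_rel_def directed_set_def)

lemma filterlim_tails_snd:
  assumes "directed_set A r" "directed_set B s"
  shows "filterlim snd (tails B s) (tails (A \<times> B) (product_rel r s))"
  unfolding filterlim_iff eventually_tails[OF assms(2)] eventually_tails[OF directed_set_product[OF assms]]
  using assms(1) by (fastforce simp: product_rel_def directed_set_def)

lemma limitin_filterlim:
  assumes "limitin X f l G" "filterlim g G F"
  shows "limitin X (\<lambda>a. f (g a)) l F"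
  using assms unfolding limitin_def filterlim_iff by blast

context
  fixes X :: "'a::dedekind_complete_vector_lattice topology"
  assumes uoX: "uo_Lebesgue_topology X" and HX: "Hausdorff_space X"
begin

private lemma ls: "locally_solid_topology X"
  using uoX by (rule uo_Lebesgue_imp_locally_solid)

text \<open>A Hausdorff uo-Lebesgue topology coincides with its own unbounded modification, by uniqueness.\<close>

lemma unbounded_topology_id: "unbounded_topology {\<lambda>x. x} X = X"
proof (rule Hausdorff_uo_Lebesgue_unique)
  show "uo_Lebesgue_topology (unbounded_topology {\<lambda>x. x} X)"
    by (rule uo_Lebesgue_unbounded_topology[OF uoX]) (auto simp: linear_id[unfolded id_def])
  show "Hausdorff_space (unbounded_topology {\<lambda>x. x} X)"
    by (rule Hausdorff_unbounded_topology[OF uoX _ _ HX]) (auto simp: linear_id[unfolded id_def])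
qed (rule uoX HX)+

lemma limitin_zero_unboundedI:
  assumes "\<And>w. 0 \<le> w \<Longrightarrow> limitin X (\<lambda>a. inf \<bar>f a\<bar> w) 0 F"
  shows "limitin X f 0 F"
proof -
  have "limitin (unbounded_topology {\<lambda>x. x} X) f 0 F"
    by (subst limitin_unbounded_topology[OF uoX]) (use assms in \<open>auto simp: linear_id[unfolded id_def]\<close>)
  then show ?thesis by (simp only: unbounded_topology_id)
qed

lemma uo_topology_obop:
  "(uo_topology :: 'a obop topology) = unbounded_topology {\<lambda>T. apply_op T x | x. 0 \<le> x} X"
proof (rule uo_topology_eq)
  let ?\<Phi> = "{\<lambda>T::'a obop. apply_op T x | x. 0 \<le> x}"
  have lin: "linear \<phi>" if \<phi>: "\<phi> \<in> ?\<Phi>" for \<phi>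
  proof -
    obtain x where "\<phi> = (\<lambda>T. apply_op T x)" using \<phi> by blast
    then show ?thesis by (simp add: linearI scaleR_obop.rep_eq)
  qed
  have pos: "0 \<le> \<phi> T" if "\<phi> \<in> ?\<Phi>" "0 \<le> T" for \<phi> T
    using that by (auto simp: apply_op_nonneg)
  show "uo_Lebesgue_topology (unbounded_topology ?\<Phi> X)"
  proof (rule uo_Lebesgue_unbounded_topology[OF uoX])
    show "decreases_to_zero B s (\<lambda>b. \<phi> (y b))"
      if \<phi>: "\<phi> \<in> ?\<Phi>" and y: "decreases_to_zero B s y" for \<phi> and B :: "'a obop set" and s y
    proof -
      obtain x where "\<phi> = (\<lambda>T. apply_op T x)" "0 \<le> x" using \<phi> by blast
      then show ?thesis using evaluation_order_continuous[OF y, of x] by simp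
    qed
  qed (erule lin, erule pos, assumption)
  have sep: "T = 0" if T: "0 \<le> T" "\<And>\<phi>. \<phi> \<in> ?\<Phi> \<Longrightarrow> \<phi> T = 0" for T
  proof (rule order.antisym)
    have "apply_op T x = 0" if "0 \<le> x" for x using T(2)[of "\<lambda>T. apply_op T x"] that by blast
    then show "T \<le> 0" by (intro apply_op_leI) (simp add: zero_obop.rep_eq)
  qed (rule T)
  show "Hausdorff_space (unbounded_topology ?\<Phi> X)"
  proof (rule Hausdorff_unbounded_topology[OF uoX _ _ HX])
    show "T = 0" if "0 \<le> T" "\<And>\<phi>. \<phi> \<in> ?\<Phi> \<Longrightarrow> \<phi> T = 0" for T
      using that by (rule sep)
  qed (erule lin, erule pos, assumption)
qed

lemma limitin_uo_topology_obop:
  "limitin uo_topology T L F \<longleftrightarrow>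
     (\<forall>x\<ge>0. \<forall>R\<ge>0. limitin X (\<lambda>a. apply_op (inf \<bar>T a - L\<bar> R) x) 0 F)"
proof -
  have lin: "linear (\<lambda>T::'a obop. apply_op T x)" for x
    by (simp add: linearI scaleR_obop.rep_eq)
  show ?thesis
    unfolding uo_topology_obop
    by (subst limitin_unbounded_topology[OF uoX]) (auto simp: lin apply_op_nonneg)
qed

text \<open>Bands are closed: if \<open>q\<close> is the component of \<open>\<bar>l\<bar>\<close> disjoint from \<open>B\<close>, then
\<open>q = \<bar>l\<bar> \<sqinter> q\<close>, whereas \<open>\<bar>f a\<bar> \<sqinter> q = 0\<close>, so \<open>q \<le> \<bar>f a - l\<bar>\<close>.\<close>

lemma band_limit:
  assumes B: "band B" and F: "F \<noteq> bot" and f: "eventually (\<lambda>a. f a \<in> B) F" and lim: "limitin X f l F"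
  shows "l \<in> B"
proof -
  obtain p q where pq: "\<bar>l\<bar> = p + q" "0 \<le> p" "0 \<le> q" "p \<in> B" "\<forall>z\<in>B. z \<le> \<bar>l\<bar> \<longrightarrow> z \<le> p"
    "\<forall>z\<in>B. 0 \<le> z \<longrightarrow> inf z q = 0"
    by (rule band_decomp[OF B abs_ge_zero])
  have "q = 0"
  proof (rule Hausdorff_zero_nbhd[OF ls HX])
    fix U assume "zero_nbhd X U"
    then obtain V where V: "solid V" "zero_nbhd X V" "V \<subseteq> U" using solid_zero_nbhd[OF ls] by blast
    have "limitin X (\<lambda>a. f a - l) 0 F" using lim by (simp only: limitin_offset_locally_solid[OF ls])
    from eventually_conj[OF f limitin_eventually_zero_nbhd[OF this V(2)]]
    obtain a where a: "f a \<in> B" "f a - l \<in> V" using eventually_happens'[OF F] by blast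
    have "\<bar>f a\<bar> \<in> B" using solidD[OF bandD(2)[OF B] a(1)] by simp
    then have "inf \<bar>f a\<bar> q = 0" using pq(6) by simp
    moreover have "inf \<bar>l\<bar> q = q" using pq(1-3) by (simp add: inf_absorb2)
    ultimately have "q \<le> inf \<bar>\<bar>l\<bar> - \<bar>f a\<bar>\<bar> q"
      using abs_inf_diff_le[of "\<bar>l\<bar>" "\<bar>f a\<bar>" q] pq(3) by simp
    also have "\<dots> \<le> \<bar>f a - l\<bar>"
      using abs_triangle_ineq3[of l "f a"] by (simp add: abs_minus_commute le_infI1)
    finally have "\<bar>q\<bar> \<le> \<bar>f a - l\<bar>" using pq(3) by simp
    then have "q \<in> V" by (rule solidD[OF V(1) a(2)])
    then show "q \<in> U" using V by blast
  qed
  then have "\<bar>l\<bar> \<in> B" using pq by simp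
  then show ?thesis using solidD[OF bandD(2)[OF B], of "\<bar>l\<bar>" l] by simp
qed

lemma Orth_pointwise_limit:
  assumes F: "F \<noteq> bot" and T: "eventually (\<lambda>a. T a \<in> Orth) F"
    and lim: "\<And>x. 0 \<le> x \<Longrightarrow> limitin X (\<lambda>a. apply_op (T a) x) (apply_op L x) F"
  shows "L \<in> Orth"
proof (rule OrthI)
  fix B :: "'a set" and x assume B: "band B" and x: "x \<in> B"
  have *: "apply_op L u \<in> B" if u: "0 \<le> u" "u \<in> B" for u
  proof (rule band_limit[OF B F _ lim[OF u(1)]])
    show "eventually (\<lambda>a. apply_op (T a) u \<in> B) F"
      using T by eventually_elim (rule OrthD[OF _ B u(2)])
  qed
  have "\<bar>x\<bar> \<in> B" using solidD[OF bandD(2)[OF B] x] by simp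
  moreover have "pprt x \<le> \<bar>x\<bar>" "- nprt x \<le> \<bar>x\<bar>" by (simp_all add: abs_prts)
  ultimately have "pprt x \<in> B" "- nprt x \<in> B"
    using solidD_nonneg[OF bandD(2)[OF B]] zero_le_pprt[of x] nprt_le_zero[of x]
    by (metis neg_0_le_iff_le)+
  then have "apply_op L (pprt x) - apply_op L (- nprt x) \<in> B"
    by (intro subspace_diff[OF bandD(1)[OF B]] *) auto
  then show "apply_op L x \<in> B"
    using arg_cong[OF prts[of x], of "apply_op L"] by simp
qed

text \<open>Convergence in the operator lattice does not control \<open>T\<^sub>a x\<close> directly, but it controls the truncated
operators \<open>\<bar>T\<^sub>a\<bar> \<sqinter> \<bar>L\<bar>\<close>. These are orthomorphisms that converge pointwise to \<open>\<bar>L\<bar>\<close>.\<close>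

lemma Orth_uo_limit:
  fixes L :: "'a obop"
  assumes F: "F \<noteq> bot" and T: "eventually (\<lambda>a. T a \<in> Orth) F" and lim: "limitin uo_topology T L F"
  shows "L \<in> Orth"
proof -
  have "\<bar>L\<bar> \<in> Orth"
  proof (rule Orth_pointwise_limit[OF F])
    show "eventually (\<lambda>a. inf \<bar>T a\<bar> \<bar>L\<bar> \<in> Orth) F"
      using T by eventually_elim (erule Orth_dominated, simp)
    fix x :: 'a assume x: "0 \<le> x"
    have "limitin X (\<lambda>a. apply_op (inf \<bar>T a - L\<bar> \<bar>L\<bar>) x) 0 F"
      using lim x unfolding limitin_uo_topology_obop by simp
    then have "limitin X (\<lambda>a. apply_op (inf \<bar>T a\<bar> \<bar>L\<bar>) x - apply_op \<bar>L\<bar> x) 0 F"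
    proof (rule limitin_squeeze_locally_solid[OF ls], intro always_eventually allI)
      fix a
      have "\<bar>inf \<bar>T a\<bar> \<bar>L\<bar> - inf \<bar>L\<bar> \<bar>L\<bar>\<bar> \<le> inf \<bar>\<bar>T a\<bar> - \<bar>L\<bar>\<bar> \<bar>L\<bar>"
        by (rule abs_inf_diff_le) auto
      also have "\<dots> \<le> inf \<bar>T a - L\<bar> \<bar>L\<bar>"
        by (intro inf_mono abs_triangle_ineq3 order_refl)
      finally have le: "\<bar>inf \<bar>T a\<bar> \<bar>L\<bar> - \<bar>L\<bar>\<bar> \<le> inf \<bar>T a - L\<bar> \<bar>L\<bar>" by simp
      have "\<bar>apply_op (inf \<bar>T a\<bar> \<bar>L\<bar> - \<bar>L\<bar>) x\<bar> \<le> apply_op \<bar>inf \<bar>T a\<bar> \<bar>L\<bar> - \<bar>L\<bar>\<bar> \<bar>x\<bar>"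
        by (rule abs_apply_op_le)
      also have "\<dots> \<le> apply_op (inf \<bar>T a - L\<bar> \<bar>L\<bar>) \<bar>x\<bar>"
        by (rule apply_op_leD[OF le]) simp
      finally show "\<bar>apply_op (inf \<bar>T a\<bar> \<bar>L\<bar>) x - apply_op \<bar>L\<bar> x\<bar> \<le> \<bar>apply_op (inf \<bar>T a - L\<bar> \<bar>L\<bar>) x\<bar>"
        using x by (auto intro: order.trans abs_ge_self)
    qed
    then show "limitin X (\<lambda>a. apply_op (inf \<bar>T a\<bar> \<bar>L\<bar>) x) (apply_op \<bar>L\<bar> x) F"
      by (simp only: limitin_offset_locally_solid[OF ls])
  qed
  then show ?thesis by (rule Orth_dominated) simp
qed

lemma op_conv_Orth_limit:
  fixes L :: "'a obop"
  assumes A: "directed_set A r" and T: "\<forall>a\<in>A. T a \<in> Orth" and conv: "op_conv c A r T L"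
  shows "L \<in> Orth"
proof (cases c)
  case Uo_Lebesgue
  then show ?thesis
    using Orth_uo_limit[OF tails_neq_bot[OF A] eventually_tails_member[OF A T]] conv by simp
next
  case Strong_uo_Lebesgue
  then show ?thesis
    using Orth_pointwise_limit[OF tails_neq_bot[OF A] eventually_tails_member[OF A T]] conv
    by (simp add: uo_topology_eq[OF uoX HX])
qed

text \<open>For convergence in the operator lattice one truncates by the identity: with \<open>y = x + w\<close> and
\<open>D = \<bar>T\<^sub>a - L\<bar>\<close> one has \<open>D x \<sqinter> w \<le> D y \<sqinter> y \<le> 2 (D \<sqinter> I) y\<close>. For strong convergence,
\<open>\<bar>T\<^sub>a - L\<bar> x = \<bar>(T\<^sub>a - L) x\<bar>\<close>.\<close>

lemma op_conv_imp_abs_null: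
  assumes A: "directed_set A r" and T: "\<forall>a\<in>A. T a \<in> Orth" and conv: "op_conv c A r T L" and x: "0 \<le> x"
  shows "limitin X (\<lambda>a. apply_op \<bar>T a - L\<bar> x) 0 (tails A r)"
proof -
  have L: "L \<in> Orth" using A T conv by (rule op_conv_Orth_limit)
  have D: "eventually (\<lambda>a. T a - L \<in> Orth) (tails A r)"
    using T L by (intro eventually_tails_member[OF A]) (simp add: Orth_diff)
  show ?thesis
  proof (cases c)
    case Uo_Lebesgue
    then have lim: "limitin X (\<lambda>a. apply_op (inf \<bar>T a - L\<bar> R) y) 0 (tails A r)" if "0 \<le> y" "0 \<le> R" for y R
      using conv that by (simp add: limitin_uo_topology_obop)
    show ?thesis
    proof (rule limitin_zero_unboundedI)
      fix w :: 'a assume w: "0 \<le> w"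
      have "limitin X (\<lambda>a. 2 *\<^sub>R apply_op (inf \<bar>T a - L\<bar> id_op) (x + w)) (2 *\<^sub>R 0) (tails A r)"
        using x w by (intro limitin_scaleR_locally_solid[OF ls] tendsto_const lim) (auto simp: id_op_nonneg)
      then show "limitin X (\<lambda>a. inf \<bar>apply_op \<bar>T a - L\<bar> x\<bar> w) 0 (tails A r)"
        unfolding scaleR_zero_right
      proof (rule limitin_squeeze_nonneg[OF ls])
        show "eventually (\<lambda>a. inf \<bar>apply_op \<bar>T a - L\<bar> x\<bar> w \<le> 2 *\<^sub>R apply_op (inf \<bar>T a - L\<bar> id_op) (x + w)) (tails A r)"
          using D
        proof eventually_elim
          fix a assume "T a - L \<in> Orth"
          then have Orth: "\<bar>T a - L\<bar> \<in> Orth" by (rule Orth_abs)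
          have "inf \<bar>apply_op \<bar>T a - L\<bar> x\<bar> w \<le> inf (apply_op \<bar>T a - L\<bar> (x + w)) (x + w)"
            using x w by (intro inf_mono) (simp_all add: apply_op_nonneg del: apply_op_minus)
          also have "\<dots> = inf (apply_op \<bar>T a - L\<bar> (x + w)) (apply_op id_op (x + w))"
            by (simp add: id_op.rep_eq)
          also have "\<dots> \<le> 2 *\<^sub>R apply_op (inf \<bar>T a - L\<bar> id_op) (x + w)"
            using x w by (intro Orth_inf_apply_le Orth id_op_Orth id_op_nonneg) auto
          finally show "inf \<bar>apply_op \<bar>T a - L\<bar> x\<bar> w \<le> 2 *\<^sub>R apply_op (inf \<bar>T a - L\<bar> id_op) (x + w)" .
        qed
      qed (use w in simp)
    qed
  next
    case Strong_uo_Lebesgue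
    then have "limitin X (\<lambda>a. apply_op (T a) x - apply_op L x) 0 (tails A r)"
      using conv by (simp add: uo_topology_eq[OF uoX HX] limitin_offset_locally_solid[OF ls])
    then show ?thesis
    proof (rule limitin_squeeze_locally_solid[OF ls])
      show "eventually (\<lambda>a. \<bar>apply_op \<bar>T a - L\<bar> x\<bar> \<le> \<bar>apply_op (T a) x - apply_op L x\<bar>) (tails A r)"
        using D by eventually_elim (simp add: Orth_abs_apply x)
    qed
  qed
qed

lemma abs_null_imp_op_conv:
  assumes null: "\<And>x. 0 \<le> x \<Longrightarrow> limitin X (\<lambda>a. apply_op \<bar>T a - L\<bar> x) 0 (tails A r)"
  shows "op_conv c A r T L"
proof (cases c)
  case Uo_Lebesgue
  have "limitin X (\<lambda>a. apply_op (inf \<bar>T a - L\<bar> R) x) 0 (tails A r)" if "0 \<le> x" "0 \<le> R" for x R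
    by (rule limitin_squeeze_nonneg[OF ls null[OF that(1)]])
      (use that in \<open>auto intro!: apply_op_nonneg apply_op_leD always_eventually\<close>)
  then show ?thesis using Uo_Lebesgue by (simp add: limitin_uo_topology_obop)
next
  case Strong_uo_Lebesgue
  have "limitin X (\<lambda>a. apply_op (T a) x - apply_op L x) 0 (tails A r)" for x
  proof (rule limitin_squeeze_locally_solid[OF ls null[OF abs_ge_zero[of x]]], intro always_eventually allI)
    fix a
    show "\<bar>apply_op (T a) x - apply_op L x\<bar> \<le> \<bar>apply_op \<bar>T a - L\<bar> \<bar>x\<bar>\<bar>"
      using abs_apply_op_le[of "T a - L" x] by (auto intro: order.trans abs_ge_self)
  qed
  then show ?thesis
    using Strong_uo_Lebesgue by (simp add: uo_topology_eq[OF uoX HX] limitin_offset_locally_solid[OF ls])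
qed

text \<open>Applying \<open>Orth_inf_le_add\<close> to \<open>T / k\<close> and \<open>k f\<close> gives \<open>T f \<sqinter> w \<le> T w / k + k f\<close>. The first summand is small
for large \<open>k\<close>, and for that fixed \<open>k\<close> the second one tends to zero.\<close>

lemma Orth_limitin_zero:
  assumes T: "T \<in> Orth" "0 \<le> T" and f: "\<And>a. 0 \<le> f a" "limitin X f 0 F"
  shows "limitin X (\<lambda>a. apply_op T (f a)) 0 F"
proof (rule limitin_zero_unboundedI)
  fix w :: 'a assume w: "0 \<le> w"
  show "limitin X (\<lambda>a. inf \<bar>apply_op T (f a)\<bar> w) 0 F"
    unfolding limitin_def
  proof (intro conjI allI impI)
    fix U assume "openin X U \<and> 0 \<in> U"
    then obtain U' where U': "solid U'" "zero_nbhd X U'" "U' \<subseteq> U"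
      using solid_zero_nbhd[OF ls] zero_nbhd_openin by metis
    obtain V where V: "solid V" "zero_nbhd X V" "\<forall>x\<in>V. \<forall>y\<in>V. x + y \<in> U'"
      by (rule half_zero_nbhd[OF ls U'(2)])
    have "limitin X (\<lambda>n. inverse (real (Suc n)) *\<^sub>R apply_op T w) (0 *\<^sub>R apply_op T w) sequentially"
      by (intro limitin_scaleR_locally_solid[OF ls] limitin_const_locally_solid[OF ls] LIMSEQ_inverse_real_of_nat)
    then have "eventually (\<lambda>n. inverse (real (Suc n)) *\<^sub>R apply_op T w \<in> V) sequentially"
      using V(2) by (intro limitin_eventually_zero_nbhd) simp
    then obtain n where n: "inverse (real (Suc n)) *\<^sub>R apply_op T w \<in> V"
      by (auto simp: eventually_sequentially)
    define k where "k = real (Suc n)"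
    have k: "0 < k" "inverse k *\<^sub>R apply_op T w \<in> V" using n by (auto simp: k_def)
    have "limitin X (\<lambda>a. k *\<^sub>R f a) (k *\<^sub>R 0) F"
      by (intro limitin_scaleR_locally_solid[OF ls] tendsto_const f)
    then have "eventually (\<lambda>a. k *\<^sub>R f a \<in> V) F"
      using V(2) by (intro limitin_eventually_zero_nbhd) simp
    then show "eventually (\<lambda>a. inf \<bar>apply_op T (f a)\<bar> w \<in> U) F"
    proof eventually_elim
      fix a assume a: "k *\<^sub>R f a \<in> V"
      have "inf (apply_op (inverse k *\<^sub>R T) (k *\<^sub>R f a)) w \<le> apply_op (inverse k *\<^sub>R T) w + k *\<^sub>R f a"
        using T f(1)[of a] k w by (intro Orth_inf_le_add Orth_scaleR scaleR_nonneg_nonneg) auto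
      then have le: "inf (apply_op T (f a)) w \<le> inverse k *\<^sub>R apply_op T w + k *\<^sub>R f a"
        using k by (simp add: scaleR_obop.rep_eq)
      have "inverse k *\<^sub>R apply_op T w + k *\<^sub>R f a \<in> U'" by (rule bspec[OF bspec[OF V(3) k(2)] a])
      then have "inf (apply_op T (f a)) w \<in> U'"
        by (rule solidD_nonneg[OF U'(1) _ _ le]) (use w apply_op_nonneg[OF T(2) f(1)] in simp)
      then show "inf \<bar>apply_op T (f a)\<bar> w \<in> U"
        using U'(3) apply_op_nonneg[OF T(2) f(1)[of a]] by auto
    qed
  qed (simp add: topspace_locally_solid[OF ls])
qed

text \<open>Expand \<open>S T - S' T' = (S - S') (T - T') + (S - S') T' + S' (T - T')\<close>. The middle term is handled
by the hypothesis on \<open>S\<close>, the last one by \<open>Orth_limitin_zero\<close>, and the first one by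
truncation and \<open>Orth_inf_le_add\<close>.\<close>

lemma abs_null_compose:
  assumes S: "eventually (\<lambda>p. S p \<in> Orth) F" and S': "S' \<in> Orth"
    and S_null: "\<And>x. 0 \<le> x \<Longrightarrow> limitin X (\<lambda>p. apply_op \<bar>S p - S'\<bar> x) 0 F"
    and T: "eventually (\<lambda>p. T p \<in> Orth) F" and T': "T' \<in> Orth"
    and T_null: "\<And>x. 0 \<le> x \<Longrightarrow> limitin X (\<lambda>p. apply_op \<bar>T p - T'\<bar> x) 0 F"
    and x: "0 \<le> x"
  shows "limitin X (\<lambda>p. apply_op \<bar>(S p \<circ>\<^sub>o T p) - (S' \<circ>\<^sub>o T')\<bar> x) 0 F"
proof -
  let ?A = "\<lambda>p. apply_op \<bar>S p - S'\<bar>" and ?B = "\<lambda>p. apply_op \<bar>T p - T'\<bar>"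
  have B_nonneg: "0 \<le> ?B p x" for p using x by (intro apply_op_nonneg) auto
  have AB_nonneg: "0 \<le> ?A p (?B p x)" for p by (rule apply_op_nonneg[OF abs_ge_zero B_nonneg])
  have AB: "limitin X (\<lambda>p. ?A p (?B p x)) 0 F"
  proof (rule limitin_zero_unboundedI)
    fix w :: 'a assume w: "0 \<le> w"
    have "limitin X (\<lambda>p. ?A p w + ?B p x) (0 + 0) F"
      by (intro limitin_add_locally_solid[OF ls] S_null T_null w x)
    then show "limitin X (\<lambda>p. inf \<bar>?A p (?B p x)\<bar> w) 0 F"
      unfolding add_0
    proof (rule limitin_squeeze_nonneg[OF ls])
      show "eventually (\<lambda>p. inf \<bar>?A p (?B p x)\<bar> w \<le> ?A p w + ?B p x) F"
        using S
      proof eventually_elim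
        fix p assume "S p \<in> Orth"
        then have "inf (?A p (?B p x)) w \<le> ?A p w + ?B p x"
          using S' B_nonneg w by (intro Orth_inf_le_add Orth_abs Orth_diff) auto
        then show "inf \<bar>?A p (?B p x)\<bar> w \<le> ?A p w + ?B p x"
          by (simp only: abs_of_nonneg[OF AB_nonneg])
      qed
    qed (use w in simp)
  qed
  have SB: "limitin X (\<lambda>p. apply_op \<bar>S'\<bar> (?B p x)) 0 F"
    by (rule Orth_limitin_zero[OF Orth_abs[OF S'] abs_ge_zero B_nonneg T_null[OF x]])
  have "limitin X (\<lambda>p. ?A p (?B p x) + ?A p \<bar>apply_op T' x\<bar> + apply_op \<bar>S'\<bar> (?B p x)) (0 + 0 + 0) F"
    by (intro limitin_add_locally_solid[OF ls] AB SB S_null abs_ge_zero)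
  then show ?thesis
    unfolding add_0
  proof (rule limitin_squeeze_nonneg[OF ls])
    show "0 \<le> apply_op \<bar>(S p \<circ>\<^sub>o T p) - (S' \<circ>\<^sub>o T')\<bar> x" for p using x by (intro apply_op_nonneg) auto
    show "eventually (\<lambda>p. apply_op \<bar>(S p \<circ>\<^sub>o T p) - (S' \<circ>\<^sub>o T')\<bar> x
       \<le> ?A p (?B p x) + ?A p \<bar>apply_op T' x\<bar> + apply_op \<bar>S'\<bar> (?B p x)) F"
      using S T
    proof eventually_elim
      fix p assume p: "S p \<in> Orth" "T p \<in> Orth"
      let ?y = "apply_op (T p - T') x"
      have y: "\<bar>?y\<bar> \<le> ?B p x" using abs_apply_op_le[of "T p - T'" x] x by simp
      have mono: "\<bar>apply_op R ?y\<bar> \<le> apply_op \<bar>R\<bar> (?B p x)" for R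
        using abs_apply_op_le[of R ?y] apply_op_mono[OF abs_ge_zero[of R] y] by (rule order.trans)
      have "apply_op \<bar>(S p \<circ>\<^sub>o T p) - (S' \<circ>\<^sub>o T')\<bar> x = \<bar>apply_op ((S p \<circ>\<^sub>o T p) - (S' \<circ>\<^sub>o T')) x\<bar>"
        by (intro Orth_abs_apply Orth_diff Orth_compose p S' T' x)
      also have "apply_op ((S p \<circ>\<^sub>o T p) - (S' \<circ>\<^sub>o T')) x =
        apply_op (S p - S') ?y + apply_op (S p - S') (apply_op T' x) + apply_op S' ?y"
        by (simp add: compose_op.rep_eq algebra_simps)
      also have "\<bar>\<dots>\<bar> \<le> \<bar>apply_op (S p - S') ?y\<bar> + \<bar>apply_op (S p - S') (apply_op T' x)\<bar> + \<bar>apply_op S' ?y\<bar>"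
        by (intro order.trans[OF abs_triangle_ineq] add_mono order_refl abs_triangle_ineq)
      also have "\<dots> \<le> ?A p (?B p x) + ?A p \<bar>apply_op T' x\<bar> + apply_op \<bar>S'\<bar> (?B p x)"
        by (intro add_mono mono abs_apply_op_le)
      finally show "apply_op \<bar>(S p \<circ>\<^sub>o T p) - (S' \<circ>\<^sub>o T')\<bar> x
         \<le> ?A p (?B p x) + ?A p \<bar>apply_op T' x\<bar> + apply_op \<bar>S'\<bar> (?B p x)" .
    qed
  qed
qed

end

theorem proposition5p11:
  fixes S :: "'i \<Rightarrow> 'a::dedekind_complete_vector_lattice obop" and S_lim :: "'a obop"
    and T :: "'j \<Rightarrow> 'a obop" and T_lim :: "'a obop"
    and A :: "'i set" and r :: "'i rel" and B :: "'j set" and s :: "'j rel"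
    and c1 c2 c3 :: op_convergence
  assumes "\<exists>X :: 'a topology. uo_Lebesgue_topology X \<and> Hausdorff_space X"
    and "directed_set A r" and "\<forall>a\<in>A. S a \<in> Orth" and "op_conv c1 A r S S_lim"
    and "directed_set B s" and "\<forall>b\<in>B. T b \<in> Orth" and "op_conv c2 B s T T_lim"
  shows "S_lim \<in> Orth \<and> T_lim \<in> Orth \<and>
    op_conv c3 (A \<times> B) (product_rel r s) (\<lambda>(a, b). S a \<circ>\<^sub>o T b) (S_lim \<circ>\<^sub>o T_lim)"
proof (intro conjI)
  note A = assms(2-4) and B = assms(5-7)
  obtain X :: "'a topology" where X: "uo_Lebesgue_topology X" "Hausdorff_space X"
    using assms(1) by blast
  show S_lim: "S_lim \<in> Orth" by (rule op_conv_Orth_limit[OF X A])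
  show T_lim: "T_lim \<in> Orth" by (rule op_conv_Orth_limit[OF X B])
  have AB: "directed_set (A \<times> B) (product_rel r s)" by (rule directed_set_product[OF A(1) B(1)])
  show "op_conv c3 (A \<times> B) (product_rel r s) (\<lambda>(a, b). S a \<circ>\<^sub>o T b) (S_lim \<circ>\<^sub>o T_lim)"
    unfolding case_prod_unfold
  proof (rule abs_null_imp_op_conv[OF X], rule abs_null_compose[OF X])
    show "eventually (\<lambda>p. S (fst p) \<in> Orth) (tails (A \<times> B) (product_rel r s))"
      using A(2) by (intro eventually_tails_member[OF AB]) auto
    show "eventually (\<lambda>p. T (snd p) \<in> Orth) (tails (A \<times> B) (product_rel r s))"
      using B(2) by (intro eventually_tails_member[OF AB]) auto
    show "limitin X (\<lambda>p. apply_op \<bar>S (fst p) - S_lim\<bar> x) 0 (tails (A \<times> B) (product_rel r s))" if "0 \<le> x" for x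
      by (rule limitin_filterlim[OF op_conv_imp_abs_null[OF X A that] filterlim_tails_fst[OF A(1) B(1)]])
    show "limitin X (\<lambda>p. apply_op \<bar>T (snd p) - T_lim\<bar> x) 0 (tails (A \<times> B) (product_rel r s))" if "0 \<le> x" for x
      by (rule limitin_filterlim[OF op_conv_imp_abs_null[OF X B that] filterlim_tails_snd[OF A(1) B(1)]])
  qed (use S_lim T_lim in auto)
qed

end
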